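(* Let $(X,\mathcal R)$ be an imprimitive $d$-class symmetric association scheme with a fixed imprimitivity system. Then $(X,\mathcal R)$ is uniform if and only if it is Q-Higman.
   Context: A (symmetric) $d$-class association scheme $(X,\mathcal R)$, $|X|=v$, consists of a partition $\mathcal R=\{R_0,\dots,R_d\}$ of $X\times X$ with $R_0$ the diagonal, each $R_i$ symmetric, and intersection numbers $p^h_{ij}$ (for $(x,y)\in R_h$, the number of $z$ with $(x,z)\in R_i,(z,y)\in R_j$ is $p^h_{ij}$). With $A_i$ the adjacency matrices, the Bose–Mesner algebra $\mathcal A=\langle A_0,\dots,A_d\rangle$ has a basis of primitive idempotents $E_0=\frac1vJ,E_1,\dots,E_d$; $m_j=\operatorname{rank}E_j$; the Krein parameters $q^h_{ij}$ are defined by $E_i\circ E_j=\frac1v\sum_h q^h_{ij}E_h$ ($\circ$ entrywise product). Imprimitivity system: a partition of $X$ into $w$ fibres of size $n$ together with index sets $\mathcal I,\mathcal J$ with $\{0\}\subsetneq\mathcal I,\mathcal J\subsetneq\{0,\dots,d\}$ such that $\sum_{i\in\mathcal I}A_i=n\sum_{j\in\mathcal J}E_j$ equals the $0/1$ matrix whose $(x,y)$ entry is $1$ iff $x,y$ lie in the same fibre. Define $i\sim^* j$ iff $q^h_{ij}\neq0$ for some $h\in\mathcal J$; this is an equivalence relation. For fibres $U,V$ let $\mathcal I(U,V)$ be the set of $i$ with $R_i\cap(U\times V)\ne\emptyset$, and $M^{UV}$ the matrix agreeing with $M$ on $U\times V$ and zero elsewhere. The scheme is uniform if $\mathcal I(U,V)=\{0,\dots,d\}\setminus\mathcal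 I$ for all distinct fibres $U,V$ and there are integers $a^h_{ij}$ with $A_i^{UV}A_j^{VW}=\sum_h a^h_{ij}A_h^{UW}$ for all fibres $U,V,W$ and $i\in\mathcal I(U,V)$, $j\in\mathcal I(V,W)$. The scheme is Q-Higman if for some $\ell$ with $1\le\ell<\frac d2+1$ and some ordering of the primitive idempotents: $\mathcal J=\{0,d\}$, the $\sim^*$-classes are $\{j,d-j\}$ for $j=0,\dots,\ell-1$ and $\{j\}$ for $j=\ell,\dots,d-\ell$, and $q^d_{jj}=0$ (equivalently $m_{d-j}=(w-1)m_j$) for $j=0,\dots,\ell-1$. *)

theory Defs
  imports "HOL-Analysis.Analysis" "HOL-Library.Disjoint_Sets" "HOL-Combinatorics.Permutations"
begin

text \<open>The vertex set is the finite type \<open>'x\<close>, so \<open>v = CARD('x)\<close>. All indices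
  range over \<open>{..d}\<close>; values of index families beyond \<open>d\<close> are irrelevant.\<close>

definition assoc_scheme :: "nat \<Rightarrow> (nat \<Rightarrow> ('x::finite \<times> 'x) set) \<Rightarrow> bool" where
  "assoc_scheme d R \<longleftrightarrow>
     partition_on UNIV (R ` {..d}) \<and> inj_on R {..d} \<and>
     R 0 = Id \<and>
     (\<forall>i\<le>d. sym (R i)) \<and>
     (\<forall>h\<le>d. \<forall>i\<le>d. \<forall>j\<le>d. \<exists>p::nat. \<forall>(x, y)\<in>R h.
        card {z. (x, z) \<in> R i \<and> (z, y) \<in> R j} = p)"

definition adj :: "('x::finite \<times> 'x) set \<Rightarrow> real ^ 'x ^ 'x" where
  "adj S = (\<chi> x y. if (x, y) \<in> S then 1 else 0)"

definition all_ones :: "real ^ 'x::finite ^ 'x" where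
  "all_ones = (\<chi> x y. 1)"

definition hadamard :: "real ^ 'x::finite ^ 'x \<Rightarrow> real ^ 'x ^ 'x \<Rightarrow> real ^ 'x ^ 'x" where
  "hadamard M N = (\<chi> x y. M $ x $ y * N $ x $ y)"

definition bose_mesner :: "nat \<Rightarrow> (nat \<Rightarrow> ('x::finite \<times> 'x) set) \<Rightarrow> (real ^ 'x ^ 'x) set" where
  "bose_mesner d R = span ((\<lambda>i. adj (R i)) ` {..d})"

definition primitive_idempotent_in :: "(real ^ 'x::finite ^ 'x) set \<Rightarrow> real ^ 'x ^ 'x \<Rightarrow> bool" where
  "primitive_idempotent_in \<A> M \<longleftrightarrow>
     M \<in> \<A> \<and> M ** M = M \<and> M \<noteq> 0 \<and>
     \<not> (\<exists>F\<in>\<A>. \<exists>G\<in>\<A>. F ** F = F \<and> G ** G = G \<and> F \<noteq> 0 \<and> G \<noteq> 0 \<and>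
          F ** G = 0 \<and> G ** F = 0 \<and> M = F + G)"

definition idempotent_ordering ::
    "nat \<Rightarrow> (nat \<Rightarrow> ('x::finite \<times> 'x) set) \<Rightarrow> (nat \<Rightarrow> real ^ 'x ^ 'x) \<Rightarrow> bool" where
  "idempotent_ordering d R E \<longleftrightarrow>
     bij_betw E {..d} {M. primitive_idempotent_in (bose_mesner d R) M} \<and>
     E 0 = (1 / real CARD('x)) *\<^sub>R all_ones"

text \<open>\<open>krein d E h i j\<close> is \<open>q\<^sup>h\<^sub>i\<^sub>j\<close>. For \<open>h \<le> d\<close> the chosen coefficient is unique,
  since \<open>E 0, \<dots>, E d\<close> is a basis of the Bose--Mesner algebra.\<close>

definition krein :: "nat \<Rightarrow> (nat \<Rightarrow> real ^ 'x::finite ^ 'x) \<Rightarrow> nat \<Rightarrow> nat \<Rightarrow> nat \<Rightarrow> real" where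
  "krein d E h i j =
     (SOME q. hadamard (E i) (E j) = (1 / real CARD('x)) *\<^sub>R (\<Sum>k\<le>d. q k *\<^sub>R E k)) h"

definition fibre_matrix :: "'x::finite set set \<Rightarrow> real ^ 'x ^ 'x" where
  "fibre_matrix P = (\<chi> x y. if \<exists>U\<in>P. x \<in> U \<and> y \<in> U then 1 else 0)"

definition imprimitivity_system ::
    "nat \<Rightarrow> (nat \<Rightarrow> ('x::finite \<times> 'x) set) \<Rightarrow> (nat \<Rightarrow> real ^ 'x ^ 'x) \<Rightarrow>
     'x set set \<Rightarrow> nat \<Rightarrow> nat \<Rightarrow> nat set \<Rightarrow> nat set \<Rightarrow> bool" where
  "imprimitivity_system d R E P w n I J \<longleftrightarrow>
     partition_on UNIV P \<and> card P = w \<and> (\<forall>U\<in>P. card U = n) \<and>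
     {0} \<subset> I \<and> I \<subset> {..d} \<and> {0} \<subset> J \<and> J \<subset> {..d} \<and>
     (\<Sum>i\<in>I. adj (R i)) = fibre_matrix P \<and>
     real n *\<^sub>R (\<Sum>j\<in>J. E j) = fibre_matrix P"

definition sim_star :: "nat \<Rightarrow> (nat \<Rightarrow> real ^ 'x::finite ^ 'x) \<Rightarrow> nat set \<Rightarrow> (nat \<times> nat) set" where
  "sim_star d E J = {(i, j). i \<le> d \<and> j \<le> d \<and> (\<exists>h\<in>J. krein d E h i j \<noteq> 0)}"

definition rel_indices ::
    "nat \<Rightarrow> (nat \<Rightarrow> ('x::finite \<times> 'x) set) \<Rightarrow> 'x set \<Rightarrow> 'x set \<Rightarrow> nat set" where
  "rel_indices d R U V = {i. i \<le> d \<and> R i \<inter> (U \<times> V) \<noteq> {}}"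

definition block :: "'x::finite set \<Rightarrow> 'x set \<Rightarrow> real ^ 'x ^ 'x \<Rightarrow> real ^ 'x ^ 'x" where
  "block U V M = (\<chi> x y. if x \<in> U \<and> y \<in> V then M $ x $ y else 0)"

definition uniform_scheme ::
    "nat \<Rightarrow> (nat \<Rightarrow> ('x::finite \<times> 'x) set) \<Rightarrow> 'x set set \<Rightarrow> nat set \<Rightarrow> bool" where
  "uniform_scheme d R P I \<longleftrightarrow>
     (\<forall>U\<in>P. \<forall>V\<in>P. U \<noteq> V \<longrightarrow> rel_indices d R U V = {..d} - I) \<and>
     (\<exists>a :: nat \<Rightarrow> nat \<Rightarrow> nat \<Rightarrow> int.
        \<forall>U\<in>P. \<forall>V\<in>P. \<forall>W\<in>P. \<forall>i\<in>rel_indices d R U V. \<forall>j\<in>rel_indices d R V W.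
          block U V (adj (R i)) ** block V W (adj (R j)) =
            (\<Sum>h\<le>d. real_of_int (a h i j) *\<^sub>R block U W (adj (R h))))"

text \<open>A reordering of the idempotents is \<open>E \<circ> \<sigma>\<close> for a permutation \<open>\<sigma>\<close> of \<open>{..d}\<close> fixing \<open>0\<close>
  (the trivial idempotent is always listed first); the same idempotents that \<open>J\<close> indexes
  in the ordering \<open>E\<close> are indexed by \<open>{j. j \<le> d \<and> \<sigma> j \<in> J}\<close> in \<open>E \<circ> \<sigma>\<close>.
  The bound \<open>2 * l < d + 2\<close> is \<open>l < d/2 + 1\<close>.\<close>

definition Q_Higman_wrt :: "nat \<Rightarrow> (nat \<Rightarrow> real ^ 'x::finite ^ 'x) \<Rightarrow> nat set \<Rightarrow> nat \<Rightarrow> bool" where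
  "Q_Higman_wrt d E J l \<longleftrightarrow>
     J = {0, d} \<and>
     {..d} // sim_star d E J = {{j, d - j} |j. j < l} \<union> {{j} |j. l \<le> j \<and> j \<le> d - l} \<and>
     (\<forall>j<l. krein d E d j j = 0)"

definition Q_Higman :: "nat \<Rightarrow> (nat \<Rightarrow> real ^ 'x::finite ^ 'x) \<Rightarrow> nat set \<Rightarrow> bool" where
  "Q_Higman d E J \<longleftrightarrow>
     (\<exists>l \<sigma>. 1 \<le> l \<and> 2 * l < d + 2 \<and> \<sigma> permutes {..d} \<and> \<sigma> 0 = 0 \<and>
        Q_Higman_wrt d (E \<circ> \<sigma>) {j. j \<le> d \<and> \<sigma> j \<in> J} l)"

end

theory Submission
  imports Defs
begin

text \<open>
  Let \<open>F\<close> be the fibre matrix, \<open>D M\<close> the block diagonal part \<open>F \<circ> M\<close> and \<open>1\<^sub>V\<close> the coordinate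
  projection onto a fibre \<open>V\<close>. Both properties are equivalent to the following condition on the
  primitive idempotents: each \<open>E\<^sub>k\<close> is block diagonal or belongs to a pair \<open>E\<^sub>i, E\<^sub>j\<close> with
  \<open>D E\<^sub>i = (E\<^sub>i + E\<^sub>j) / w\<close>. On the dual side this is read off from
  \<open>w \<cdot> D E\<^sub>j = E\<^sub>j + \<Sum>\<^sub>k q\<^sup>k\<^sub>d\<^sub>j E\<^sub>k\<close>, valid for \<open>\<J> = {0, d}\<close>.

  If the scheme is uniform, let \<open>e\<close> be a primitive idempotent of the block diagonal subalgebra and let
  \<open>M, N\<close> be elements of \<open>e\<A>\<close> with zero block diagonal part. Then \<open>1\<^sub>U M 1\<^sub>V N 1\<^sub>U = c e 1\<^sub>U\<close> with \<open>c\<close>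
  independent of the fibres \<open>U \<noteq> V\<close>, which forces \<open>M\<close> and \<open>N\<close> to be proportional. After scaling \<open>N\<close>,
  the matrix \<open>(e + N) / w\<close> is idempotent, hence one of the \<open>E\<^sub>i\<close>.

  Conversely, for a pair as above \<open>w E\<^sub>i 1\<^sub>V E\<^sub>i\<close> is an idempotent below \<open>E\<^sub>i\<close> of the same trace, so
  \<open>E\<^sub>i 1\<^sub>V E\<^sub>i = E\<^sub>i / w\<close> for every fibre \<open>V\<close>. Off the diagonal blocks every element of the algebra
  agrees with a combination of these \<open>E\<^sub>i\<close>, so products of blocks do not depend on the middle fibre.
\<close>

section \<open>Matrices and the Bose--Mesner algebra\<close>

lemma matrix_mul_scaleR [simp]:
  fixes A B :: "real ^ 'x::finite ^ 'x"
  shows "(c *\<^sub>R A) ** B = c *\<^sub>R (A ** B)" "A ** (c *\<^sub>R B) = c *\<^sub>R (A ** B)"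
  by (simp_all add: vec_eq_iff matrix_matrix_mult_def sum_distrib_left mult_ac)

lemma matrix_add_rdistrib: "(A + B) ** C = A ** C + B ** (C :: real ^ 'x::finite ^ 'x)"
  and matrix_diff_ldistrib: "C ** (A - B) = C ** A - C ** B"
  and matrix_diff_rdistrib: "(A - B) ** C = A ** C - B ** C"
  by (simp_all add: vec_eq_iff matrix_matrix_mult_def algebra_simps sum.distrib sum_subtractf)

lemma matrix_mul_zero [simp]: "A ** 0 = 0" "0 ** A = (0 :: real ^ 'x::finite ^ 'x)"
  by (simp_all add: vec_eq_iff matrix_matrix_mult_def)

lemmas matrix_distribs = matrix_add_ldistrib matrix_add_rdistrib matrix_diff_ldistrib matrix_diff_rdistrib

lemma trace_zero [simp]: "trace (0 :: real ^ 'x::finite ^ 'x) = 0"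
  by (simp add: trace_def)

lemma matrix_mul_sum:
  fixes B :: "real ^ 'x::finite ^ 'x"
  shows "(\<Sum>i\<in>S. f i) ** B = (\<Sum>i\<in>S. f i ** B)" "B ** (\<Sum>i\<in>S. f i) = (\<Sum>i\<in>S. B ** f i)"
  by (induction S rule: infinite_finite_induct)
     (simp_all add: matrix_add_ldistrib matrix_add_rdistrib)

lemma trace_scaleR: "trace (c *\<^sub>R A) = c * trace (A :: real ^ 'x::finite ^ 'x)"
  by (simp add: trace_def sum_distrib_left)

lemma trace_sum: "trace (\<Sum>i\<in>S. f i :: real ^ 'x::finite ^ 'x) = (\<Sum>i\<in>S. trace (f i))"
  by (induction S rule: infinite_finite_induct) (simp_all add: trace_add)

lemma transpose_scaleR: "transpose (c *\<^sub>R A) = c *\<^sub>R transpose (A :: real ^ 'x::finite ^ 'x)"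
  by (simp add: transpose_def vec_eq_iff)

text \<open>The squared Frobenius norm. Positivity of traces of idempotents, and every argument that
  a matrix of trace zero vanishes, rest on it.\<close>

lemma trace_mult_transpose:
  "trace (A ** transpose A) = (\<Sum>x\<in>UNIV. \<Sum>y\<in>UNIV. (A $ x $ y)\<^sup>2)" for A :: "real ^ 'x::finite ^ 'x"
  by (simp add: trace_def matrix_matrix_mult_def transpose_def power2_eq_square)

lemma trace_mult_transpose_nonneg: "0 \<le> trace (A ** transpose A)" for A :: "real ^ 'x::finite ^ 'x"
  by (simp add: trace_mult_transpose sum_nonneg)

lemma trace_mult_transpose_eq_0_iff:
  "trace (A ** transpose A) = 0 \<longleftrightarrow> A = 0" for A :: "real ^ 'x::finite ^ 'x"
  by (simp add: trace_mult_transpose sum_nonneg_eq_0_iff sum_nonneg vec_eq_iff)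

lemma trace_mult_transpose_pos:
  "A \<noteq> 0 \<Longrightarrow> 0 < trace (A ** transpose A)" for A :: "real ^ 'x::finite ^ 'x"
  using trace_mult_transpose_nonneg[of A] trace_mult_transpose_eq_0_iff[of A] by linarith

section \<open>Coordinate projections and blocks\<close>

text \<open>Multiplying by such projections on both sides cuts out a block, so that statements about
  blocks become matrix identities.\<close>

definition coord_proj :: "'x::finite set \<Rightarrow> real ^ 'x ^ 'x" where
  "coord_proj V = (\<chi> x y. if x = y \<and> x \<in> V then 1 else 0)"

lemma coord_proj_mult_nth:
  "(coord_proj V ** M) $ x $ y = (if x \<in> V then M $ x $ y else 0)"
proof -
  have "(coord_proj V ** M) $ x $ y = (\<Sum>z\<in>UNIV. if z = x then (if x \<in> V then M $ x $ y else 0) else 0)"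
    unfolding matrix_matrix_mult_def coord_proj_def vec_lambda_beta by (intro sum.cong) auto
  then show ?thesis by simp
qed

lemma mult_coord_proj_nth:
  "(M ** coord_proj V) $ x $ y = (if y \<in> V then M $ x $ y else 0)"
proof -
  have "(M ** coord_proj V) $ x $ y = (\<Sum>z\<in>UNIV. if z = y then (if y \<in> V then M $ x $ y else 0) else 0)"
    unfolding matrix_matrix_mult_def coord_proj_def vec_lambda_beta by (intro sum.cong) auto
  then show ?thesis by simp
qed

lemma block_eq: "block U V M = coord_proj U ** M ** coord_proj V"
  by (simp add: vec_eq_iff block_def coord_proj_mult_nth mult_coord_proj_nth)

lemma coord_proj_idem: "coord_proj V ** coord_proj V = coord_proj V"
  by (simp add: vec_eq_iff coord_proj_mult_nth) (simp add: coord_proj_def)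

lemma coord_proj_idem': "M ** coord_proj V ** coord_proj V = M ** coord_proj V"
  by (simp add: coord_proj_idem flip: matrix_mul_assoc)

lemma coord_proj_disjoint: "U \<inter> V = {} \<Longrightarrow> coord_proj U ** coord_proj V = 0"
  by (auto simp add: vec_eq_iff coord_proj_mult_nth) (auto simp: coord_proj_def)

lemma transpose_coord_proj: "transpose (coord_proj V) = coord_proj V"
  by (auto simp: vec_eq_iff transpose_def coord_proj_def)

lemma partition_on_unique:
  assumes "partition_on A P" "U \<in> P" "V \<in> P" "x \<in> U" "x \<in> V"
  shows "U = V"
proof -
  have "U \<inter> V \<noteq> {}" "disjoint P" using assms by (auto simp: partition_on_def)
  then show ?thesis using assms(2,3) unfolding disjoint_def by metis
qed

lemma sum_coord_proj:
  assumes "partition_on UNIV P"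
  shows "(\<Sum>V\<in>P. coord_proj V) = mat 1"
proof -
  have fin: "finite P" by simp
  have "(\<Sum>V\<in>P. coord_proj V $ x $ y) = (mat 1 :: real ^ 'a ^ 'a) $ x $ y" for x y :: 'a
  proof -
    obtain U where U: "U \<in> P" "x \<in> U" using assms unfolding partition_on_def by (metis UNIV_I UnionE)
    have uniq: "V = U" if "V \<in> P" "x \<in> V" for V
      using partition_on_unique[OF assms that(1) U(1) that(2) U(2)] .
    have "(\<Sum>V\<in>P. coord_proj V $ x $ y) = (\<Sum>V\<in>P. if V = U then (if x = y then 1 else 0) else 0)"
      using U by (intro sum.cong) (auto simp: coord_proj_def dest: uniq)
    then show ?thesis using U by (simp add: mat_def)
  qed
  then show ?thesis by (simp add: vec_eq_iff)
qed

section \<open>Entrywise description of the Bose-Mesner algebra\<close>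

lemma assoc_scheme_cover:
  assumes "assoc_scheme d R"
  obtains h where "h \<le> d" "(x, y) \<in> R h"
proof -
  have "(x, y) \<in> \<Union> (R ` {..d})"
    using assms unfolding assoc_scheme_def partition_on_def by simp
  then show ?thesis using that by auto
qed

lemma assoc_scheme_unique:
  assumes "assoc_scheme d R" "h \<le> d" "i \<le> d" "(x, y) \<in> R h" "(x, y) \<in> R i"
  shows "h = i"
proof -
  have "disjoint (R ` {..d})" "inj_on R {..d}"
    using assms unfolding assoc_scheme_def partition_on_def by auto
  moreover have "R h \<inter> R i \<noteq> {}" using assms by blast
  ultimately have "R h = R i" using assms(2,3) unfolding disjoint_def by (meson atMost_iff imageI)
  then show ?thesis using \<open>inj_on R {..d}\<close> assms(2,3) by (simp add: inj_on_eq_iff)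
qed

lemma assoc_scheme_nonempty:
  assumes "assoc_scheme d R" "i \<le> d"
  shows "R i \<noteq> {}"
proof -
  have "{} \<notin> R ` {..d}" using assms(1) unfolding assoc_scheme_def partition_on_def by simp
  then show ?thesis using assms(2) by (metis atMost_iff imageI)
qed

lemma assoc_scheme_sum_adj_nth:
  assumes "assoc_scheme d R" "h \<le> d" "(x, y) \<in> R h"
  shows "(\<Sum>k\<le>d. c k *\<^sub>R adj (R k)) $ x $ y = c h"
proof -
  have "(\<Sum>k\<le>d. c k *\<^sub>R adj (R k)) $ x $ y = (\<Sum>k\<le>d. if k = h then c h else 0)"
    unfolding sum_component using assms(3)
    by (intro sum.cong) (auto simp: adj_def dest: assoc_scheme_unique[OF assms(1,2) _ assms(3)])
  then show ?thesis using assms by simp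
qed

lemma bose_mesner_expand:
  assumes "assoc_scheme d R" "\<And>h x y. h \<le> d \<Longrightarrow> (x, y) \<in> R h \<Longrightarrow> M $ x $ y = c h"
  shows "M = (\<Sum>h\<le>d. c h *\<^sub>R adj (R h))"
proof -
  have "M $ x $ y = (\<Sum>k\<le>d. c k *\<^sub>R adj (R k)) $ x $ y" for x y
  proof -
    obtain h where h: "h \<le> d" "(x, y) \<in> R h" using assoc_scheme_cover[OF assms(1)] .
    show ?thesis using assms(2)[OF h] assoc_scheme_sum_adj_nth[OF assms(1) h] by metis
  qed
  then show ?thesis unfolding vec_eq_iff by blast
qed

text \<open>The relations partition the pairs of points, so a linear combination of adjacency
  matrices is a matrix constant on each relation. Closure under both products is then checked entry
  by entry.\<close>

lemma bose_mesner_iff: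
  assumes "assoc_scheme d R"
  shows "M \<in> bose_mesner d R \<longleftrightarrow> (\<exists>c. \<forall>h\<le>d. \<forall>x y. (x, y) \<in> R h \<longrightarrow> M $ x $ y = c h)"
proof
  assume "M \<in> bose_mesner d R"
  then obtain c where "M = (\<Sum>v\<in>(\<lambda>i. adj (R i)) ` {..d}. c v *\<^sub>R v)"
    unfolding bose_mesner_def by (auto simp: span_finite)
  then show "\<exists>c. \<forall>h\<le>d. \<forall>x y. (x, y) \<in> R h \<longrightarrow> M $ x $ y = c h"
  proof -
    \<comment> \<open>The span is described by coefficients on the set of matrices; nonempty
      relations keep the adjacency matrices distinct, so these can be reindexed by
      \<open>{..d}\<close>.\<close>
    have "inj_on (\<lambda>i. adj (R i)) {..d}"
    proof (rule inj_onI)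
      fix i j assume ij: "i \<in> {..d}" "j \<in> {..d}" "adj (R i) = adj (R j)"
      have "R i \<noteq> {}" using assoc_scheme_nonempty[OF assms] ij(1) by simp
      then obtain x y where xy: "(x, y) \<in> R i" by auto
      have "adj (R i) $ x $ y = 1" using xy by (simp add: adj_def)
      then have "adj (R j) $ x $ y = 1" using ij(3) by simp
      then have "(x, y) \<in> R j" by (simp add: adj_def split: if_splits)
      with xy ij show "i = j" using assoc_scheme_unique[OF assms] by auto
    qed
    with \<open>M = _\<close> have "M = (\<Sum>i\<le>d. c (adj (R i)) *\<^sub>R adj (R i))"
      by (simp add: sum.reindex)
    then show ?thesis using assoc_scheme_sum_adj_nth[OF assms, where c = "\<lambda>i. c (adj (R i))"] by metis
  qed
next
  assume "\<exists>c. \<forall>h\<le>d. \<forall>x y. (x, y) \<in> R h \<longrightarrow> M $ x $ y = c h"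
  then obtain c where "M = (\<Sum>h\<le>d. c h *\<^sub>R adj (R h))"
    using bose_mesner_expand[OF assms] by metis
  then show "M \<in> bose_mesner d R"
    unfolding bose_mesner_def by (auto intro!: span_sum span_scale intro: span_base)
qed

lemma adj_mult_nth:
  "(adj S ** adj T) $ x $ y = real (card {z. (x, z) \<in> S \<and> (z, y) \<in> T})"
proof -
  have "(adj S ** adj T) $ x $ y = (\<Sum>z\<in>UNIV. if z \<in> {z. (x, z) \<in> S \<and> (z, y) \<in> T} then 1 else 0)"
    unfolding matrix_matrix_mult_def adj_def by (auto intro!: sum.cong)
  then show ?thesis by (simp add: sum.If_cases)
qed

section \<open>Primitive idempotents and coefficients\<close>

locale scheme_idempotents =
  fixes R :: "nat \<Rightarrow> ('x::finite \<times> 'x) set"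
    and E :: "nat \<Rightarrow> real ^ 'x ^ 'x"
    and d :: nat
  assumes scheme: "assoc_scheme d R"
    and ordering: "idempotent_ordering d R E"
begin

abbreviation "\<A> \<equiv> bose_mesner d R"

lemma \<A>_subspace: "subspace \<A>"
  by (simp add: bose_mesner_def)

lemmas \<A>_intros = subspace_add[OF \<A>_subspace] subspace_diff[OF \<A>_subspace]
  subspace_scale[OF \<A>_subspace] subspace_sum[OF \<A>_subspace] subspace_0[OF \<A>_subspace]

lemma adj_in: "i \<le> d \<Longrightarrow> adj (R i) \<in> \<A>"
  unfolding bose_mesner_def by (auto intro: span_base)

lemma \<A>_sum_adj: "M \<in> \<A> \<Longrightarrow> \<exists>c. M = (\<Sum>i\<le>d. c i *\<^sub>R adj (R i))"
  using bose_mesner_iff[OF scheme] bose_mesner_expand[OF scheme] by metis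

lemma \<A>_symmetric:
  assumes "M \<in> \<A>"
  shows "transpose M = M"
proof -
  obtain c where c: "\<And>h x y. h \<le> d \<Longrightarrow> (x, y) \<in> R h \<Longrightarrow> M $ x $ y = c h"
    using assms bose_mesner_iff[OF scheme] by metis
  have "M $ y $ x = M $ x $ y" for x y
  proof -
    obtain h where h: "h \<le> d" "(x, y) \<in> R h" using assoc_scheme_cover[OF scheme] .
    then have "(y, x) \<in> R h" using scheme unfolding assoc_scheme_def sym_def by blast
    then show ?thesis using c h by metis
  qed
  then show ?thesis by (simp add: transpose_def vec_eq_iff)
qed

lemma \<A>_hadamard:
  assumes "M \<in> \<A>" "N \<in> \<A>"
  shows "hadamard M N \<in> \<A>"
proof -
  obtain c where "\<And>h x y. h \<le> d \<Longrightarrow> (x, y) \<in> R h \<Longrightarrow> M $ x $ y = c h"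
    using assms(1) bose_mesner_iff[OF scheme] by metis
  moreover obtain c' where "\<And>h x y. h \<le> d \<Longrightarrow> (x, y) \<in> R h \<Longrightarrow> N $ x $ y = c' h"
    using assms(2) bose_mesner_iff[OF scheme] by metis
  ultimately have "\<forall>h\<le>d. \<forall>x y. (x, y) \<in> R h \<longrightarrow> hadamard M N $ x $ y = c h * c' h"
    by (simp add: hadamard_def)
  then show ?thesis unfolding bose_mesner_iff[OF scheme] by (intro exI[of _ "\<lambda>h. c h * c' h"])
qed

lemma \<A>_mult:
  assumes "M \<in> \<A>" "N \<in> \<A>"
  shows "M ** N \<in> \<A>"
proof -
  have adj: "adj (R i) ** adj (R j) \<in> \<A>" if "i \<le> d" "j \<le> d" for i j
  proof -
    have "\<forall>h. \<exists>p. h \<le> d \<longrightarrow> (\<forall>(x, y)\<in>R h. card {z. (x, z) \<in> R i \<and> (z, y) \<in> R j} = p)"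
      using scheme that unfolding assoc_scheme_def by simp
    from choice[OF this] obtain p where
      "\<And>h. h \<le> d \<Longrightarrow> \<forall>(x, y)\<in>R h. card {z. (x, z) \<in> R i \<and> (z, y) \<in> R j} = p h"
      by blast
    then have "\<forall>h\<le>d. \<forall>x y. (x, y) \<in> R h \<longrightarrow> (adj (R i) ** adj (R j)) $ x $ y = real (p h)"
      by (auto simp: adj_mult_nth)
    then show ?thesis unfolding bose_mesner_iff[OF scheme] by (intro exI[of _ "\<lambda>h. real (p h)"])
  qed
  obtain c c' where "M = (\<Sum>i\<le>d. c i *\<^sub>R adj (R i))" "N = (\<Sum>i\<le>d. c' i *\<^sub>R adj (R i))"
    using assms[THEN \<A>_sum_adj] by blast
  then show ?thesis
    by (auto simp: matrix_mul_sum intro!: \<A>_intros adj)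
qed

text \<open>A product of two members is again a member, hence symmetric, and transposing it swaps
  the factors.\<close>

lemma \<A>_commute: "M \<in> \<A> \<Longrightarrow> N \<in> \<A> \<Longrightarrow> M ** N = N ** M"
  using \<A>_mult[of M N] \<A>_symmetric[of "M ** N"] \<A>_symmetric[of M] \<A>_symmetric[of N]
  by (simp add: matrix_transpose_mul)

lemma mat_1_in: "mat 1 \<in> \<A>"
proof -
  have "adj (R 0) = mat 1"
    using scheme unfolding assoc_scheme_def by (simp add: adj_def mat_def vec_eq_iff)
  then show ?thesis using adj_in[of 0] by simp
qed

lemma E_primitive: "i \<le> d \<Longrightarrow> primitive_idempotent_in \<A> (E i)"
  using ordering unfolding idempotent_ordering_def bij_betw_def by blast

lemma E_in [simp]: "i \<le> d \<Longrightarrow> E i \<in> \<A>"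
  using E_primitive unfolding primitive_idempotent_in_def by blast

lemma E_idem: "i \<le> d \<Longrightarrow> E i ** E i = E i"
  using E_primitive unfolding primitive_idempotent_in_def by blast

lemma E_nonzero: "i \<le> d \<Longrightarrow> E i \<noteq> 0"
  using E_primitive unfolding primitive_idempotent_in_def by blast

lemma E_inj: "i \<le> d \<Longrightarrow> j \<le> d \<Longrightarrow> E i = E j \<Longrightarrow> i = j"
  using ordering unfolding idempotent_ordering_def bij_betw_def inj_on_def by auto

lemma E_0: "E 0 = (1 / real CARD('x)) *\<^sub>R all_ones"
  using ordering unfolding idempotent_ordering_def by blast

text \<open>A nonzero product \<open>E i ** E j\<close> different from \<open>E i\<close> would
  split \<open>E i\<close> into two orthogonal idempotents, namely itself and its complement in
  \<open>E i\<close>. Primitivity thus makes a nonzero product equal to both \<open>E i\<close> and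
  \<open>E j\<close>.\<close>

lemma E_orthogonal:
  assumes "i \<le> d" "j \<le> d" "i \<noteq> j"
  shows "E i ** E j = 0"
proof (rule ccontr)
  assume nz: "E i ** E j \<noteq> 0"
  have absorb: "E i ** E j = E i" if "i \<le> d" "j \<le> d" "E i ** E j \<noteq> 0" for i j
  proof (rule ccontr)
    assume neq: "E i ** E j \<noteq> E i"
    let ?F = "E i ** E j" and ?G = "E i - E i ** E j"
    have comm: "E j ** E i = E i ** E j" using that \<A>_commute by simp
    have FF: "?F ** ?F = ?F" "?F ** E i = ?F" "E i ** ?F = ?F"
    proof -
      show a: "?F ** E i = ?F" using comm that by (metis matrix_mul_assoc E_idem)
      show "E i ** ?F = ?F" using that by (simp add: matrix_mul_assoc E_idem)
      show "?F ** ?F = ?F" using that a by (simp add: matrix_mul_assoc) (simp add: E_idem flip: matrix_mul_assoc)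
    qed
    have "?F \<in> \<A>" "?G \<in> \<A>" using that by (auto intro!: \<A>_mult \<A>_intros)
    moreover have "?G ** ?G = ?G" "?F ** ?G = 0" "?G ** ?F = 0"
      using FF that E_idem by (simp_all add: matrix_diff_ldistrib matrix_diff_rdistrib)
    moreover have "?G \<noteq> 0" "E i = ?F + ?G" using neq by auto
    ultimately show False
      using E_primitive[OF that(1)] FF(1) that(3) unfolding primitive_idempotent_in_def by blast
  qed
  have "E i = E j"
    using absorb[of i j] absorb[of j i] \<A>_commute[of "E i" "E j"] assms nz by simp
  then show False using E_inj assms by blast
qed

lemma trace_E_pos: "i \<le> d \<Longrightarrow> 0 < trace (E i)"
  using trace_mult_transpose_pos[OF E_nonzero] \<A>_symmetric[OF E_in] E_idem by metis

text \<open>The eigenvalue of \<open>M\<close> on the image of \<open>E k\<close>, when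
  \<open>M\<close> is in the algebra. The trace formula makes it linear before the
  \<open>E k\<close> are known to form a basis.\<close>

definition coef :: "nat \<Rightarrow> real ^ 'x ^ 'x \<Rightarrow> real" where
  "coef k M = trace (M ** E k) / trace (E k)"

lemma coef_add: "coef k (M + N) = coef k M + coef k N"
  and coef_diff: "coef k (M - N) = coef k M - coef k N"
  and coef_scaleR: "coef k (c *\<^sub>R M) = c * coef k M"
  and coef_0: "coef k 0 = 0"
  and coef_sum: "coef k (\<Sum>i\<in>S. f i) = (\<Sum>i\<in>S. coef k (f i))"
  by (simp_all add: coef_def matrix_add_rdistrib matrix_diff_rdistrib trace_add trace_sub
      trace_scaleR trace_sum matrix_mul_sum add_divide_distrib diff_divide_distrib sum_divide_distrib)

lemmas coef_linear = coef_add coef_diff coef_scaleR coef_0 coef_sum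

lemma coef_E: "i \<le> d \<Longrightarrow> k \<le> d \<Longrightarrow> coef k (E i) = (if i = k then 1 else 0)"
  using trace_E_pos[of k] by (simp add: coef_def E_orthogonal E_idem)

text \<open>Dimension count: the \<open>d + 1\<close> orthogonal idempotents are independent, and
  the algebra is spanned by \<open>d + 1\<close> adjacency matrices.\<close>

lemma \<A>_expand:
  assumes "M \<in> \<A>"
  shows "M = (\<Sum>k\<le>d. coef k M *\<^sub>R E k)"
proof -
  have inj: "inj_on E {..d}" using E_inj by (auto intro: inj_onI)
  have indep: "independent (E ` {..d})"
  proof (rule independent_if_scalars_zero)
    fix f x assume z: "(\<Sum>x\<in>E ` {..d}. f x *\<^sub>R x) = 0" and "x \<in> E ` {..d}"
    then obtain k where k: "k \<le> d" "x = E k" by auto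
    have "coef k (\<Sum>i\<le>d. f (E i) *\<^sub>R E i) = 0" using z inj by (simp add: sum.reindex coef_0)
    moreover have "coef k (\<Sum>i\<le>d. f (E i) *\<^sub>R E i) = (\<Sum>i\<le>d. if i = k then f (E k) else 0)"
      unfolding coef_sum using k by (intro sum.cong) (auto simp: coef_scaleR coef_E)
    ultimately show "f x = 0" using k by simp
  qed simp
  have "dim \<A> \<le> card ((\<lambda>i. adj (R i)) ` {..d})"
    unfolding bose_mesner_def by (simp add: dim_le_card')
  also have "\<dots> \<le> card (E ` {..d})"
    using card_image_le[of "{..d}" "\<lambda>i. adj (R i)"] card_image[OF inj] by simp
  finally have "\<A> \<subseteq> span (E ` {..d})"
    using indep E_in by (intro card_ge_dim_independent) auto
  then obtain c where "M = (\<Sum>v\<in>E ` {..d}. c v *\<^sub>R v)"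
    using assms by (auto simp: span_finite)
  then have M: "M = (\<Sum>i\<le>d. c (E i) *\<^sub>R E i)" using inj by (simp add: sum.reindex)
  have "coef k M = c (E k)" if "k \<le> d" for k
  proof -
    have "coef k M = (\<Sum>i\<le>d. if i = k then c (E k) else 0)"
      unfolding M coef_sum using that by (intro sum.cong) (auto simp: coef_scaleR coef_E)
    then show ?thesis using that by simp
  qed
  with M show ?thesis by simp
qed

lemma \<A>_eqI:
  assumes "M \<in> \<A>" "N \<in> \<A>" "\<And>k. k \<le> d \<Longrightarrow> coef k M = coef k N"
  shows "M = N"
  using \<A>_expand[OF assms(1)] \<A>_expand[OF assms(2)] assms(3) by simp

lemma mult_E:
  assumes "M \<in> \<A>" "k \<le> d"
  shows "M ** E k = coef k M *\<^sub>R E k"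
proof -
  have "M ** E k = (\<Sum>i\<le>d. coef i M *\<^sub>R (E i ** E k))"
    by (subst \<A>_expand[OF assms(1)]) (simp add: matrix_mul_sum)
  also have "\<dots> = (\<Sum>i\<le>d. if i = k then coef k M *\<^sub>R E k else 0)"
    using assms by (intro sum.cong) (auto simp: E_idem E_orthogonal)
  finally show ?thesis using assms by simp
qed

text \<open>Each \<open>coef k\<close> is a character of the algebra, so idempotents have all their
  coefficients in \<open>{0, 1}\<close>.\<close>

lemma coef_mult:
  assumes "M \<in> \<A>" "N \<in> \<A>" "k \<le> d"
  shows "coef k (M ** N) = coef k M * coef k N"
proof -
  have "M ** N ** E k = (coef k M * coef k N) *\<^sub>R E k"
    using assms by (simp add: mult_E flip: matrix_mul_assoc)
  then show ?thesis using trace_E_pos[OF assms(3)] by (simp add: coef_def trace_scaleR)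
qed

text \<open>The entrywise product stays in the algebra and so has an expansion in the
  \<open>E k\<close>; this existence is what gives meaning to the choice in
  \<open>krein\<close>.\<close>

lemma hadamard_E_krein:
  assumes "i \<le> d" "j \<le> d"
  shows "hadamard (E i) (E j) = (1 / real CARD('x)) *\<^sub>R (\<Sum>k\<le>d. krein d E k i j *\<^sub>R E k)"
proof -
  let ?H = "hadamard (E i) (E j)"
  have "?H = (1 / real CARD('x)) *\<^sub>R (\<Sum>k\<le>d. (real CARD('x) * coef k ?H) *\<^sub>R E k)"
    using \<A>_expand[OF \<A>_hadamard[OF E_in E_in]] assms by (simp add: scaleR_sum_right)
  then have "\<exists>q. ?H = (1 / real CARD('x)) *\<^sub>R (\<Sum>k\<le>d. q k *\<^sub>R E k)" by (rule exI[of _ "\<lambda>k. real CARD('x) * coef k ?H"])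
  then show ?thesis unfolding krein_def by (rule someI_ex)
qed

lemma krein_eq_coef:
  assumes "i \<le> d" "j \<le> d" "k \<le> d"
  shows "krein d E k i j = real CARD('x) * coef k (hadamard (E i) (E j))"
proof -
  have "coef k (hadamard (E i) (E j)) = (1 / real CARD('x)) * (\<Sum>h\<le>d. if h = k then krein d E k i j else 0)"
    unfolding hadamard_E_krein[OF assms(1,2)] coef_scaleR coef_sum
    using assms(3) by (intro arg_cong2[where f = "(*)"] sum.cong) (auto simp: coef_E)
  then show ?thesis using assms by simp
qed

end

section \<open>Imprimitivity systems and block diagonal parts\<close>

locale imprimitive_scheme = scheme_idempotents R E d
  for R :: "nat \<Rightarrow> ('x::finite \<times> 'x) set" and E d +
  fixes P :: "'x set set" and w n :: nat and I J :: "nat set"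
  assumes system: "imprimitivity_system d R E P w n I J"
begin

lemma P_partition: "partition_on UNIV P"
  and card_P: "card P = w"
  and card_fibre: "U \<in> P \<Longrightarrow> card U = n"
  and I_sub: "I \<subseteq> {..d}"
  and J_sub: "J \<subseteq> {..d}"
  and zero_in_J: "0 \<in> J"
  and J_nontrivial: "J \<noteq> {0}"
  and sum_I_adj: "(\<Sum>i\<in>I. adj (R i)) = fibre_matrix P"
  and sum_J_E: "real n *\<^sub>R (\<Sum>j\<in>J. E j) = fibre_matrix P"
  using system unfolding imprimitivity_system_def by auto

lemma fibre_nonempty: "U \<in> P \<Longrightarrow> U \<noteq> {}"
  using P_partition unfolding partition_on_def by auto

lemma fibre_unique: "U \<in> P \<Longrightarrow> V \<in> P \<Longrightarrow> x \<in> U \<Longrightarrow> x \<in> V \<Longrightarrow> U = V"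
  using partition_on_unique[OF P_partition] .

lemma fibre_of:
  obtains U where "U \<in> P" "x \<in> U"
proof -
  have "x \<in> \<Union> P" using P_partition unfolding partition_on_def by simp
  then show ?thesis using that by blast
qed

lemma n_pos: "0 < n"
proof -
  obtain U :: "'x set" where "U \<in> P" using fibre_of by metis
  then show ?thesis using card_fibre fibre_nonempty by (metis card_gt_0_iff finite)
qed

lemma card_UNIV_eq: "CARD('x) = w * n"
proof -
  have "CARD('x) = card (\<Union> P)" using P_partition unfolding partition_on_def by simp
  also have "\<dots> = (\<Sum>U\<in>P. card U)"
    using P_partition unfolding partition_on_def disjoint_def
    by (intro card_Union_disjoint) (auto simp: pairwise_def disjnt_def)
  finally show ?thesis using card_fibre card_P by simp
qed

lemma coef_fibre_matrix: "k \<le> d \<Longrightarrow> coef k (fibre_matrix P) = (if k \<in> J then real n else 0)"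
proof -
  assume k: "k \<le> d"
  have "coef k (fibre_matrix P) = real n * (\<Sum>j\<in>J. if j = k then 1 else 0)"
    unfolding sum_J_E[symmetric] coef_scaleR coef_sum
    using k J_sub by (intro arg_cong2[where f = "(*)"] sum.cong) (auto simp: coef_E)
  then show ?thesis using finite_subset[OF J_sub] by simp
qed

text \<open>With a single fibre the fibre matrix would be all ones, a multiple of
  \<open>E 0\<close>, forcing \<open>J = {0}\<close>.\<close>

lemma w_ge_2: "2 \<le> w"
proof (rule ccontr)
  assume "\<not> 2 \<le> w"
  moreover have "w \<noteq> 0" using card_UNIV_eq by (metis mult_0 zero_less_card_finite less_irrefl)
  ultimately have "card P = 1" using card_P by linarith
  then obtain U where U: "P = {U}" using card_1_singletonE by blast
  then have "P = {UNIV}" using P_partition unfolding partition_on_def by auto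
  then have "fibre_matrix P = all_ones" by (simp add: fibre_matrix_def all_ones_def)
  then have F: "fibre_matrix P = real CARD('x) *\<^sub>R E 0" using E_0 by simp
  have "k = 0" if "k \<in> J" for k
  proof (rule ccontr)
    assume "k \<noteq> 0"
    have k: "k \<le> d" using that J_sub by auto
    have "coef k (fibre_matrix P) = 0" unfolding F using k \<open>k \<noteq> 0\<close> by (simp add: coef_scaleR coef_E)
    then show False using coef_fibre_matrix[OF k] that n_pos by simp
  qed
  then show False using zero_in_J J_nontrivial by auto
qed

lemma w_real: "2 \<le> real w" "0 < real w" "real w \<noteq> 0"
  using w_ge_2 by auto

section \<open>The projection onto block diagonal matrices\<close>

abbreviation pr :: "'x set \<Rightarrow> real ^ 'x ^ 'x" where "pr \<equiv> coord_proj"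

lemma pr_disjoint: "U \<in> P \<Longrightarrow> V \<in> P \<Longrightarrow> U \<noteq> V \<Longrightarrow> pr U ** pr V = 0"
  using fibre_unique by (intro coord_proj_disjoint) blast

text \<open>A conditional expectation: idempotent, trace preserving, and linear over block diagonal
  matrices (\<open>bdiag_mult\<close>). As an entrywise product with the fibre matrix it maps the
  algebra to itself.\<close>

definition bdiag :: "real ^ 'x ^ 'x \<Rightarrow> real ^ 'x ^ 'x" where
  "bdiag M = hadamard (fibre_matrix P) M"

lemma bdiag_linear:
  "bdiag (M + N) = bdiag M + bdiag N" "bdiag (M - N) = bdiag M - bdiag N" "bdiag (c *\<^sub>R M) = c *\<^sub>R bdiag M" "bdiag 0 = 0"
  by (simp_all add: bdiag_def hadamard_def vec_eq_iff algebra_simps)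

lemma bdiag_sum: "bdiag (\<Sum>i\<in>S. f i) = (\<Sum>i\<in>S. bdiag (f i))"
  by (induction S rule: infinite_finite_induct) (simp_all add: bdiag_linear)

lemma fibre_matrix_in: "fibre_matrix P \<in> \<A>"
  unfolding sum_J_E[symmetric] using J_sub by (intro \<A>_intros) auto

lemma bdiag_in: "M \<in> \<A> \<Longrightarrow> bdiag M \<in> \<A>"
  unfolding bdiag_def using \<A>_hadamard fibre_matrix_in by blast

lemma bdiag_bdiag [simp]: "bdiag (bdiag M) = bdiag M"
  by (simp add: bdiag_def hadamard_def vec_eq_iff fibre_matrix_def)

lemma trace_bdiag: "trace (bdiag M) = trace M"
proof -
  have "\<exists>U\<in>P. x \<in> U" for x using fibre_of by metis
  then show ?thesis by (simp add: bdiag_def hadamard_def trace_def fibre_matrix_def)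
qed

lemma bdiag_block:
  assumes "U \<in> P" "V \<in> P"
  shows "pr U ** bdiag M ** pr V = (if U = V then pr U ** M ** pr U else 0)"
proof (cases "U = V")
  case True
  then show ?thesis using assms
    by (auto simp: vec_eq_iff coord_proj_mult_nth mult_coord_proj_nth bdiag_def hadamard_def fibre_matrix_def)
next
  case False
  have "fibre_matrix P $ x $ y = 0" if "x \<in> U" "y \<in> V" for x y
    using fibre_unique[OF assms(1), of _ x] fibre_unique[OF assms(2), of _ y] False that
    by (auto simp: fibre_matrix_def)
  with False show ?thesis
    by (auto simp: vec_eq_iff coord_proj_mult_nth mult_coord_proj_nth bdiag_def hadamard_def)
qed

lemma matrix_eq_blocksI:
  fixes M N :: "real ^ 'x ^ 'x"
  assumes "\<And>U V. U \<in> P \<Longrightarrow> V \<in> P \<Longrightarrow> pr U ** M ** pr V = pr U ** N ** pr V"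
  shows "M = N"
proof -
  have "M $ x $ y = N $ x $ y" for x y
  proof -
    obtain U where U: "U \<in> P" "x \<in> U" using fibre_of .
    obtain V where V: "V \<in> P" "y \<in> V" using fibre_of .
    have "(pr U ** M ** pr V) $ x $ y = (pr U ** N ** pr V) $ x $ y" using assms U V by simp
    then show ?thesis using U V by (simp add: coord_proj_mult_nth mult_coord_proj_nth)
  qed
  then show ?thesis by (simp add: vec_eq_iff)
qed

lemma sum_pr: "(\<Sum>V\<in>P. pr V) = mat 1"
  using sum_coord_proj[OF P_partition] .

text \<open>Inserting the identity as the sum of all \<open>pr W\<close> on either side leaves only
  the diagonal block at \<open>V\<close>.\<close>

lemma bdiag_fixed_commute:
  assumes "bdiag X = X" "V \<in> P"
  shows "pr V ** X = X ** pr V"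
proof -
  have blk: "pr U ** X ** pr W = 0" if "U \<in> P" "W \<in> P" "U \<noteq> W" for U W
    using bdiag_block[OF that(1,2), of X] assms(1) that(3) by simp
  have "pr V ** X = pr V ** X ** (\<Sum>W\<in>P. pr W)" by (simp add: sum_pr)
  also have "\<dots> = (\<Sum>W\<in>P. pr V ** X ** pr W)" by (simp add: matrix_mul_sum)
  also have "\<dots> = (\<Sum>W\<in>P. if W = V then pr V ** X ** pr V else 0)"
    using assms(2) blk by (intro sum.cong) auto
  finally have 1: "pr V ** X = pr V ** X ** pr V" using assms by simp
  have "X ** pr V = (\<Sum>W\<in>P. pr W) ** X ** pr V" by (simp add: sum_pr)
  also have "\<dots> = (\<Sum>W\<in>P. pr W ** X ** pr V)" by (simp add: matrix_mul_sum)
  also have "\<dots> = (\<Sum>W\<in>P. if W = V then pr V ** X ** pr V else 0)"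
    using assms(2) blk by (intro sum.cong) auto
  finally show ?thesis using 1 assms by simp
qed

text \<open>\<open>X\<close> commutes with every \<open>pr U\<close>, so it can be pulled out of
  each block.\<close>

lemma bdiag_mult:
  assumes "bdiag X = X"
  shows "bdiag (X ** M) = X ** bdiag M"
proof (rule matrix_eq_blocksI)
  fix U V assume UV: "U \<in> P" "V \<in> P"
  have comm: "pr U ** X = X ** pr U" using bdiag_fixed_commute[OF assms UV(1)] .
  have "pr U ** (X ** bdiag M) ** pr V = X ** (pr U ** bdiag M ** pr V)"
    using comm by (simp add: matrix_mul_assoc)
  also have "\<dots> = (if U = V then pr U ** (X ** M) ** pr U else 0)"
    using UV comm by (auto simp: bdiag_block matrix_mul_assoc)
  finally show "pr U ** bdiag (X ** M) ** pr V = pr U ** (X ** bdiag M) ** pr V"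
    using UV by (simp add: bdiag_block)
qed

lemma bdiag_mat_1: "bdiag (mat 1) = mat 1"
proof (rule matrix_eq_blocksI)
  fix U V assume "U \<in> P" "V \<in> P"
  then show "pr U ** bdiag (mat 1) ** pr V = pr U ** mat 1 ** pr V"
    by (auto simp: bdiag_block pr_disjoint)
qed

text \<open>Self-adjointness of \<open>bdiag\<close> for the trace form, from the symmetry of the
  fibre matrix. Through \<open>coef_bdiag_E_symmetric\<close> it makes the relation between
  idempotents symmetric.\<close>

lemma trace_bdiag_mult: "trace (bdiag M ** N) = trace (bdiag N ** M)"
proof -
  have "trace (bdiag M ** N) = (\<Sum>x\<in>UNIV. \<Sum>y\<in>UNIV. fibre_matrix P $ x $ y * M $ x $ y * N $ y $ x)"
    by (simp add: trace_def matrix_matrix_mult_def bdiag_def hadamard_def)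
  also have "\<dots> = (\<Sum>y\<in>UNIV. \<Sum>x\<in>UNIV. fibre_matrix P $ y $ x * N $ y $ x * M $ x $ y)"
    by (subst sum.swap) (auto simp: fibre_matrix_def intro!: sum.cong)
  also have "\<dots> = trace (bdiag N ** M)"
    by (simp add: trace_def matrix_matrix_mult_def bdiag_def hadamard_def)
  finally show ?thesis .
qed

lemma coef_bdiag_E_symmetric:
  assumes "i \<le> d" "j \<le> d"
  shows "coef i (bdiag (E j)) * trace (E i) = coef j (bdiag (E i)) * trace (E j)"
  using trace_bdiag_mult[of "E j" "E i"] trace_E_pos[OF assms(1)] trace_E_pos[OF assms(2)]
  by (simp add: coef_def)

text \<open>Members of the algebra have constant diagonal, because \<open>R 0\<close> is the
  identity relation, and each fibre holds a fraction \<open>1 / w\<close> of the points.\<close>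

lemma trace_pr_mult:
  assumes "M \<in> \<A>" "V \<in> P"
  shows "real w * trace (pr V ** M) = trace M"
proof -
  obtain c where "\<And>h x y. h \<le> d \<Longrightarrow> (x, y) \<in> R h \<Longrightarrow> M $ x $ y = c h"
    using assms(1) bose_mesner_iff[OF scheme] by metis
  moreover have "R 0 = Id" using scheme unfolding assoc_scheme_def by simp
  ultimately have diag: "M $ x $ x = c 0" for x by simp
  have "trace (pr V ** M) = (\<Sum>x\<in>UNIV. if x \<in> V then c 0 else 0)"
    unfolding trace_def coord_proj_mult_nth by (intro sum.cong) (auto simp: diag)
  also have "\<dots> = real n * c 0" using card_fibre[OF assms(2)] by (simp add: sum.If_cases)
  finally show ?thesis by (simp add: trace_def diag card_UNIV_eq)
qed

lemma trace_pr_pos: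
  assumes "M \<in> \<A>" "M ** M = M" "M \<noteq> 0" "V \<in> P"
  shows "0 < trace (pr V ** M)"
proof -
  have "0 < trace M"
    using trace_mult_transpose_pos[OF assms(3)] \<A>_symmetric[OF assms(1)] assms(2) by simp
  then show ?thesis using trace_pr_mult[OF assms(1,4)] w_real(2) by (metis zero_less_mult_pos)
qed

section \<open>Krein parameters as coefficients of block diagonal parts\<close>

text \<open>Up to the factor \<open>CARD('x)\<close>, both sides are the sum of all entries of the
  entrywise product of \<open>E h\<close>, \<open>E i\<close> and \<open>E j\<close>.\<close>

lemma krein_symmetric:
  assumes "h \<le> d" "i \<le> d" "j \<le> d"
  shows "krein d E h i j * trace (E h) = krein d E i h j * trace (E i)"
proof -
  have *: "coef h (hadamard (E i) (E j)) * trace (E h) =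
      (\<Sum>x\<in>UNIV. \<Sum>y\<in>UNIV. E i $ x $ y * E j $ x $ y * E h $ x $ y)" if "h \<le> d" for h i
  proof -
    have "E h $ y $ x = E h $ x $ y" for x y
      using \<A>_symmetric[OF E_in[OF that]] by (simp add: transpose_def vec_eq_iff)
    then show ?thesis using trace_E_pos[OF that]
      by (simp add: coef_def trace_def matrix_matrix_mult_def hadamard_def)
  qed
  have "coef h (hadamard (E i) (E j)) * trace (E h) = coef i (hadamard (E h) (E j)) * trace (E i)"
    using *[OF assms(1), of i] *[OF assms(2), of h] by (simp add: mult_ac)
  then show ?thesis using assms by (simp add: krein_eq_coef)
qed

lemma krein_eq_0_swap:
  assumes "h \<le> d" "i \<le> d" "j \<le> d"
  shows "krein d E h i j = 0 \<longleftrightarrow> krein d E i h j = 0"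
  using krein_symmetric[OF assms] trace_E_pos[OF assms(1)] trace_E_pos[OF assms(2)]
  by (metis less_irrefl mult_eq_0_iff)

lemma krein_0:
  assumes "k \<le> d" "j \<le> d"
  shows "krein d E k 0 j = (if k = j then 1 else 0)"
proof -
  have "hadamard (E 0) (E j) = (1 / real CARD('x)) *\<^sub>R E j"
    by (simp add: E_0 hadamard_def all_ones_def vec_eq_iff)
  then show ?thesis using assms by (simp add: krein_eq_coef coef_scaleR coef_E)
qed

text \<open>The fibre matrix is \<open>n\<close> times the sum of the \<open>E h\<close> with
  \<open>h\<close> in \<open>J\<close>; the factor \<open>n / CARD('x)\<close> is
  \<open>1 / w\<close>.\<close>

lemma coef_bdiag_E:
  assumes "k \<le> d" "j \<le> d"
  shows "coef k (bdiag (E j)) = (\<Sum>h\<in>J. krein d E k h j) / real w"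
proof -
  have had: "hadamard (\<Sum>h\<in>S. E h) M = (\<Sum>h\<in>S. hadamard (E h) M)" for S and M :: "real ^ 'x ^ 'x"
    by (simp add: vec_eq_iff hadamard_def sum_distrib_right)
  have "bdiag (E j) = real n *\<^sub>R (\<Sum>h\<in>J. hadamard (E h) (E j))"
    unfolding bdiag_def sum_J_E[symmetric] had[symmetric] by (simp add: vec_eq_iff hadamard_def)
  then have "coef k (bdiag (E j)) = real n * (\<Sum>h\<in>J. krein d E k h j / real CARD('x))"
    using assms J_sub by (auto simp: coef_scaleR coef_sum krein_eq_coef intro!: sum.cong)
  then show ?thesis using n_pos by (simp add: card_UNIV_eq flip: sum_divide_distrib)
qed

text \<open>For \<open>J = {0, d}\<close>, \<open>w\<close> times the coefficient of
  \<open>E k\<close> in \<open>bdiag (E j)\<close> is \<open>krein d E k d j\<close>, plus 1 if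
  \<open>k = j\<close>. Hence \<open>krein d E d j j = 0\<close> means a coefficient
  \<open>1 / w\<close>. The clause \<open>i = j\<close> accounts for
  \<open>krein d E i 0 j\<close>.\<close>

lemma Q_Higman_wrt_iff:
  assumes "J = {0, d}" "0 < d" "2 * l < d + 2"
  shows "Q_Higman_wrt d E J l \<longleftrightarrow>
     {..d} // {(i, j). i \<le> d \<and> j \<le> d \<and> (i = j \<or> coef i (bdiag (E j)) \<noteq> 0)} =
       {{j, d - j} |j. j < l} \<union> {{j} |j. l \<le> j \<and> j \<le> d - l} \<and>
     (\<forall>j<l. coef j (bdiag (E j)) = 1 / real w)"
proof -
  have c: "coef k (bdiag (E j)) = ((if k = j then 1 else 0) + krein d E k d j) / real w"
    if "k \<le> d" "j \<le> d" for k j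
    using coef_bdiag_E[OF that] krein_0[OF that] assms(1,2) by simp
  have "sim_star d E J = {(i, j). i \<le> d \<and> j \<le> d \<and> (i = j \<or> coef i (bdiag (E j)) \<noteq> 0)}"
  proof -
    have "(\<exists>h\<in>J. krein d E h i j \<noteq> 0) \<longleftrightarrow> i = j \<or> coef i (bdiag (E j)) \<noteq> 0" if "i \<le> d" "j \<le> d" for i j
    proof -
      have "(\<exists>h\<in>J. krein d E h i j \<noteq> 0) \<longleftrightarrow> krein d E i 0 j \<noteq> 0 \<or> krein d E i d j \<noteq> 0"
        using assms(1) that by (auto simp: krein_eq_0_swap)
      then show ?thesis using that w_real by (auto simp: c krein_0)
    qed
    then show ?thesis unfolding sim_star_def by auto
  qed
  moreover have "krein d E d j j = 0 \<longleftrightarrow> coef j (bdiag (E j)) = 1 / real w" if "j < l" for j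
  proof -
    have j: "j \<le> d" using that assms by linarith
    then have "krein d E d j j = 0 \<longleftrightarrow> krein d E j d j = 0" by (simp add: krein_eq_0_swap)
    then show ?thesis using j w_real by (simp add: c field_simps)
  qed
  ultimately show ?thesis unfolding Q_Higman_wrt_def using assms(1) by auto
qed

end

section \<open>Uniform schemes\<close>

context imprimitive_scheme
begin

lemma mem_I_iff:
  assumes "i \<le> d" "(x, y) \<in> R i"
  shows "i \<in> I \<longleftrightarrow> (\<exists>U\<in>P. x \<in> U \<and> y \<in> U)"
proof -
  have "fibre_matrix P $ x $ y = (\<Sum>k\<in>I. if (x, y) \<in> R k then 1 else 0)"
    unfolding sum_I_adj[symmetric] sum_component adj_def by simp
  also have "\<dots> = (\<Sum>k\<in>I. if k = i then 1 else 0)"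
    using assms I_sub by (intro sum.cong) (auto dest: assoc_scheme_unique[OF scheme assms(1) _ assms(2)])
  also have "\<dots> = (if i \<in> I then 1 else 0)" using finite_subset[OF I_sub] by simp
  finally show ?thesis by (simp add: fibre_matrix_def split: if_splits)
qed

lemma adj_block_eq_0:
  assumes "i \<in> I" "U \<in> P" "V \<in> P" "U \<noteq> V"
  shows "pr U ** adj (R i) ** pr V = 0"
proof -
  have "(x, y) \<notin> R i" if "x \<in> U" "y \<in> V" for x y
  proof
    assume "(x, y) \<in> R i"
    then obtain W where "W \<in> P" "x \<in> W" "y \<in> W" using mem_I_iff assms(1) I_sub by blast
    then show False using fibre_unique assms that by metis
  qed
  then show ?thesis
    by (auto simp: vec_eq_iff coord_proj_mult_nth mult_coord_proj_nth adj_def)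
qed

text \<open>Uniformity extends bilinearly from adjacency matrices to the whole algebra. The matrix
  \<open>X\<close> serves all fibres at once, including the case \<open>U = W\<close>.\<close>

lemma uniform_product:
  assumes "uniform_scheme d R P I" "M \<in> \<A>" "N \<in> \<A>"
  shows "\<exists>X\<in>\<A>. \<forall>U\<in>P. \<forall>V\<in>P. \<forall>W\<in>P. U \<noteq> V \<longrightarrow> V \<noteq> W \<longrightarrow>
    pr U ** M ** pr V ** N ** pr W = pr U ** X ** pr W"
proof -
  let ?S = "{..d} - I"
  obtain a :: "nat \<Rightarrow> nat \<Rightarrow> nat \<Rightarrow> int" where
    a: "\<forall>U\<in>P. \<forall>V\<in>P. \<forall>W\<in>P. \<forall>i\<in>rel_indices d R U V. \<forall>j\<in>rel_indices d R V W.
          block U V (adj (R i)) ** block V W (adj (R j)) =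
            (\<Sum>h\<le>d. real_of_int (a h i j) *\<^sub>R block U W (adj (R h)))"
    using assms(1) unfolding uniform_scheme_def by (elim conjE exE)
  have rel: "\<forall>U\<in>P. \<forall>V\<in>P. U \<noteq> V \<longrightarrow> rel_indices d R U V = ?S"
    using assms(1) unfolding uniform_scheme_def by (rule conjunct1)
  obtain c c' where M: "M = (\<Sum>i\<le>d. c i *\<^sub>R adj (R i))" and N: "N = (\<Sum>i\<le>d. c' i *\<^sub>R adj (R i))"
    using assms(2,3)[THEN \<A>_sum_adj] by blast
  define X where "X = (\<Sum>i\<in>?S. \<Sum>j\<in>?S. (c i * c' j) *\<^sub>R (\<Sum>h\<le>d. real_of_int (a h i j) *\<^sub>R adj (R h)))"
  \<comment> \<open>Relations indexed by \<open>I\<close> lie inside the fibres and vanish on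
    off-diagonal blocks.\<close>
  have off: "pr U ** (\<Sum>i\<le>d. c i *\<^sub>R adj (R i)) ** pr V = (\<Sum>i\<in>?S. c i *\<^sub>R (pr U ** adj (R i) ** pr V))"
    if "U \<in> P" "V \<in> P" "U \<noteq> V" for U V c
    unfolding matrix_mul_sum using that by (intro sum.mono_neutral_cong_right) (auto simp: adj_block_eq_0)
  have "pr U ** M ** pr V ** N ** pr W = pr U ** X ** pr W"
    if UVW: "U \<in> P" "V \<in> P" "W \<in> P" "U \<noteq> V" "V \<noteq> W" for U V W
  proof -
    have "pr U ** M ** pr V ** N ** pr W = (pr U ** M ** pr V) ** (pr V ** N ** pr W)"
      by (simp add: matrix_mul_assoc coord_proj_idem')
    also have "\<dots> = (\<Sum>i\<in>?S. \<Sum>j\<in>?S. (c i * c' j) *\<^sub>R (block U V (adj (R i)) ** block V W (adj (R j))))"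
      unfolding M N off[OF UVW(1,2,4)] off[OF UVW(2,3,5)] matrix_mul_sum(1)
      by (simp add: matrix_mul_sum(2) block_eq mult.commute)
    also have "\<dots> = (\<Sum>i\<in>?S. \<Sum>j\<in>?S. (c i * c' j) *\<^sub>R (\<Sum>h\<le>d. real_of_int (a h i j) *\<^sub>R block U W (adj (R h))))"
      using a rel UVW by (intro sum.cong refl) simp
    also have "\<dots> = pr U ** X ** pr W"
      by (simp add: X_def block_eq matrix_mul_sum)
    finally show ?thesis .
  qed
  moreover have "X \<in> \<A>" unfolding X_def by (intro \<A>_intros adj_in) auto
  ultimately show ?thesis by (intro bexI[of _ X]) blast+
qed

lemma coef_mat_1: "k \<le> d \<Longrightarrow> coef k (mat 1) = 1"
  using trace_E_pos[of k] by (simp add: coef_def)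

text \<open>The block diagonal part of the algebra is separated by its characters, so the indicator of the
  class of \<open>k\<close> is obtained by interpolation.\<close>

lemma bdiag_fixed_idempotent_exists:
  assumes "k \<le> d"
  obtains e where "e \<in> \<A>" "bdiag e = e" "e ** e = e" "e ** E k = E k"
    "\<And>X. X \<in> \<A> \<Longrightarrow> bdiag X = X \<Longrightarrow> \<exists>c. e ** X = c *\<^sub>R e"
proof -
  \<comment> \<open>The indices that some block diagonal element separates from \<open>k\<close>;
    \<open>e\<close> has to vanish exactly there.\<close>
  let ?S = "{j. j \<le> d \<and> (\<exists>X\<in>\<A>. bdiag X = X \<and> coef j X \<noteq> coef k X)}"
  have "\<exists>f\<in>\<A>. bdiag f = f \<and> coef k f = 1 \<and> (\<forall>j\<in>S. coef j f = 0)" if "finite S" "S \<subseteq> ?S" for S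
    using that
  proof (induction S rule: finite_induct)
    case empty
    show ?case using mat_1_in bdiag_mat_1 coef_mat_1 assms by blast
  next
    case (insert j S)
    then obtain f where f: "f \<in> \<A>" "bdiag f = f" "coef k f = 1" "\<forall>j\<in>S. coef j f = 0" by auto
    obtain X where j: "j \<le> d" and X: "X \<in> \<A>" "bdiag X = X" "coef j X \<noteq> coef k X" using insert by auto
    \<comment> \<open>Lagrange factor with value 1 at \<open>k\<close> and 0 at
      \<open>j\<close>.\<close>
    define g where "g = (1 / (coef k X - coef j X)) *\<^sub>R (X - coef j X *\<^sub>R mat 1)"
    have g: "g \<in> \<A>" "bdiag g = g" "coef k g = 1" "coef j g = 0"
      using X assms j mat_1_in unfolding g_def
      by (auto intro!: \<A>_intros simp: bdiag_linear bdiag_mat_1 coef_linear coef_mat_1)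
    have "\<forall>i\<in>insert j S. coef i (f ** g) = 0"
      using f g insert.prems by (auto simp: coef_mult)
    moreover have "f ** g \<in> \<A>" "bdiag (f ** g) = f ** g" "coef k (f ** g) = 1"
      using f g assms by (simp_all add: \<A>_mult bdiag_mult coef_mult)
    ultimately show ?case by blast
  qed
  from this[of ?S] obtain e where e: "e \<in> \<A>" "bdiag e = e" "coef k e = 1" "\<forall>j\<in>?S. coef j e = 0" by auto
  have c: "coef j e = (if j \<in> ?S then 0 else 1)" if "j \<le> d" for j using e that by force
  have same: "coef j X = coef k X" if "j \<le> d" "j \<notin> ?S" "X \<in> \<A>" "bdiag X = X" for j X using that by blast
  show ?thesis
  proof
    show "e \<in> \<A>" "bdiag e = e" by fact+
    show "e ** e = e" using e by (intro \<A>_eqI) (auto simp: \<A>_mult coef_mult c)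
    show "e ** E k = E k" using mult_E[OF e(1) assms] e by simp
    show "\<exists>c. e ** X = c *\<^sub>R e" if X: "X \<in> \<A>" "bdiag X = X" for X
    proof (intro exI \<A>_eqI)
      fix j assume j: "j \<le> d"
      show "coef j (e ** X) = coef j (coef k X *\<^sub>R e)"
        using same[OF j _ X] X e j by (cases "j \<in> ?S") (simp_all only: coef_mult coef_scaleR c if_True if_False, simp_all)
    qed (use X e in \<open>auto intro!: \<A>_mult \<A>_intros\<close>)
  qed
qed

end

section \<open>The ideal of a primitive block diagonal idempotent\<close>

locale uniform_idempotent = imprimitive_scheme R E d P w n I J
  for R :: "nat \<Rightarrow> ('x::finite \<times> 'x) set" and E d P w n I J +
  fixes e :: "real ^ 'x ^ 'x"
  assumes uniform: "uniform_scheme d R P I"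
    and e_in: "e \<in> \<A>"
    and bdiag_e: "bdiag e = e"
    and e_idem: "e ** e = e"
    and e_nonzero: "e \<noteq> 0"
    and e_absorb: "X \<in> \<A> \<Longrightarrow> bdiag X = X \<Longrightarrow> \<exists>c. e ** X = c *\<^sub>R e"
begin

text \<open>By \<open>e_absorb\<close>, the block diagonal elements of the ideal generated by
  \<open>e\<close> are the multiples of \<open>e\<close>. \<open>K\<close> is the complement of this
  line in the ideal, see \<open>diff_bdiag_in_K\<close>.\<close>

definition K :: "(real ^ 'x ^ 'x) set" where
  "K = {M \<in> \<A>. e ** M = M \<and> bdiag M = 0}"

lemma K_scaleR: "M \<in> K \<Longrightarrow> c *\<^sub>R M \<in> K"
  unfolding K_def using \<A>_intros(3) by (auto simp: bdiag_linear)

lemma pr_e: "U \<in> P \<Longrightarrow> pr U ** e = e ** pr U"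
  using bdiag_fixed_commute[OF bdiag_e] .

lemma pr_e': "U \<in> P \<Longrightarrow> M ** pr U ** e = M ** e ** pr U"
  using pr_e by (metis matrix_mul_assoc)

lemma K_mult_e: "M \<in> K \<Longrightarrow> M ** e = M"
  unfolding K_def using \<A>_commute e_in by (metis (mono_tags, lifting) mem_Collect_eq)

lemma K_diagonal_block: "M \<in> K \<Longrightarrow> U \<in> P \<Longrightarrow> pr U ** M ** pr U = 0"
  using bdiag_block[of U U M] unfolding K_def by simp

lemma e_block: "U \<in> P \<Longrightarrow> pr U ** e ** pr U = pr U ** e"
  by (simp add: pr_e coord_proj_idem')

lemma e_block_0: "U \<in> P \<Longrightarrow> V \<in> P \<Longrightarrow> U \<noteq> V \<Longrightarrow> pr U ** e ** pr V = 0"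
  using bdiag_block[of U V e] bdiag_e by simp

lemma bdiag_multiple_e:
  assumes "X \<in> \<A>" "e ** X = X"
  shows "\<exists>c. bdiag X = c *\<^sub>R e"
  using e_absorb[OF bdiag_in[OF assms(1)] bdiag_bdiag] bdiag_mult[OF bdiag_e, of X] assms(2) by auto

lemma diff_bdiag_in_K: "X \<in> \<A> \<Longrightarrow> e ** X = X \<Longrightarrow> X - bdiag X \<in> K"
  unfolding K_def using bdiag_mult[OF bdiag_e, of X]
  by (auto simp: bdiag_linear matrix_diff_ldistrib intro!: \<A>_intros bdiag_in)

text \<open>The matrix from \<open>uniform_product\<close> may be multiplied by \<open>e\<close>,
  because \<open>e ** M = M\<close> and \<open>e\<close> commutes with the projections. So the
  product stays in the ideal.\<close>

lemma K_product:
  assumes "M \<in> K" "N \<in> K"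
  shows "\<exists>X\<in>\<A>. e ** X = X \<and> (\<forall>U\<in>P. \<forall>V\<in>P. \<forall>W\<in>P. U \<noteq> V \<longrightarrow> V \<noteq> W \<longrightarrow>
    pr U ** M ** pr V ** N ** pr W = pr U ** X ** pr W)"
proof -
  obtain X where X: "X \<in> \<A>" "\<And>U V W. U \<in> P \<Longrightarrow> V \<in> P \<Longrightarrow> W \<in> P \<Longrightarrow> U \<noteq> V \<Longrightarrow> V \<noteq> W \<Longrightarrow>
    pr U ** M ** pr V ** N ** pr W = pr U ** X ** pr W"
    using uniform_product[OF uniform, of M N] assms unfolding K_def by auto
  have "pr U ** M ** pr V ** N ** pr W = pr U ** (e ** X) ** pr W"
    if "U \<in> P" "V \<in> P" "W \<in> P" "U \<noteq> V" "V \<noteq> W" for U V W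
  proof -
    have "pr U ** M ** pr V ** N ** pr W = pr U ** (e ** M) ** pr V ** N ** pr W"
      using assms(1) by (simp add: K_def)
    also have "\<dots> = e ** (pr U ** M ** pr V ** N ** pr W)"
      using that by (simp add: matrix_mul_assoc pr_e)
    also have "\<dots> = e ** (pr U ** X ** pr W)" using X(2)[OF that] by simp
    also have "\<dots> = pr U ** (e ** X) ** pr W" using that by (simp add: matrix_mul_assoc pr_e)
    finally show ?thesis .
  qed
  moreover have "e ** X \<in> \<A>" "e ** (e ** X) = e ** X"
    using X(1) by (simp_all add: \<A>_mult e_in e_idem matrix_mul_assoc)
  ultimately show ?thesis by (intro bexI[of _ "e ** X"]) blast+
qed

text \<open>A bilinear form on \<open>K\<close>, encoded as a relation because one value
  \<open>c\<close> must first be shown to serve all pairs of distinct fibres.\<close>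

definition pairing :: "real ^ 'x ^ 'x \<Rightarrow> real ^ 'x ^ 'x \<Rightarrow> real \<Rightarrow> bool" where
  "pairing M N c \<longleftrightarrow> (\<forall>U\<in>P. \<forall>V\<in>P. U \<noteq> V \<longrightarrow> pr U ** M ** pr V ** N ** pr U = c *\<^sub>R (pr U ** e))"

text \<open>The case \<open>U = W\<close> of \<open>K_product\<close>: the diagonal blocks of
  \<open>X\<close> are those of \<open>bdiag X\<close>, a multiple of \<open>e\<close>.\<close>

lemma pairing_exists:
  assumes "M \<in> K" "N \<in> K"
  shows "\<exists>c. pairing M N c"
proof -
  obtain X where X: "X \<in> \<A>" "e ** X = X" "\<And>U V W. U \<in> P \<Longrightarrow> V \<in> P \<Longrightarrow> W \<in> P \<Longrightarrow> U \<noteq> V \<Longrightarrow> V \<noteq> W \<Longrightarrow>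
    pr U ** M ** pr V ** N ** pr W = pr U ** X ** pr W"
    using K_product[OF assms] by auto
  obtain c where "bdiag X = c *\<^sub>R e" using bdiag_multiple_e[OF X(1,2)] by blast
  then have "pr U ** X ** pr U = c *\<^sub>R (pr U ** e)" if "U \<in> P" for U
    using bdiag_block[OF that that, of X] that by (simp add: e_block)
  then have "pairing M N c" using X(3) unfolding pairing_def by simp
  then show ?thesis by blast
qed

text \<open>By symmetry of \<open>N\<close>, the product going from \<open>U\<close> to
  \<open>V\<close> and back is a block times its own transpose. Some block with
  \<open>U \<noteq> V\<close> is nonzero, and then the trace is positive.\<close>

lemma pairing_pos:
  assumes "N \<in> K" "N \<noteq> 0" "pairing N N c"
  shows "0 < c"
proof -
  obtain U V where UV: "U \<in> P" "V \<in> P" "pr U ** N ** pr V \<noteq> 0"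
    using matrix_eq_blocksI[of N 0] assms(2) by auto
  then have "U \<noteq> V" using K_diagonal_block[OF assms(1)] by auto
  have "transpose N = N" using assms(1) \<A>_symmetric unfolding K_def by auto
  then have "transpose (pr U ** N ** pr V) = pr V ** N ** pr U"
    by (simp add: matrix_transpose_mul transpose_coord_proj matrix_mul_assoc)
  then have "(pr U ** N ** pr V) ** transpose (pr U ** N ** pr V) = pr U ** N ** pr V ** N ** pr U"
    by (simp add: matrix_mul_assoc coord_proj_idem')
  then have "0 < c * trace (pr U ** e)"
    using trace_mult_transpose_pos[OF UV(3)] assms(3) UV \<open>U \<noteq> V\<close> unfolding pairing_def
    by (simp add: trace_scaleR)
  then show ?thesis using trace_pr_pos[OF e_in e_idem e_nonzero UV(1)] by (simp add: zero_less_mult_iff)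
qed

text \<open>Evaluate \<open>pr U ** M ** pr V ** N ** pr U ** N ** pr V\<close> in two ways: pairing
  \<open>M\<close> with the first \<open>N\<close> gives \<open>b\<close> times a block of
  \<open>N\<close>, pairing the two copies of \<open>N\<close> gives \<open>c\<close> times a block
  of \<open>M\<close>.\<close>

lemma K_one_dimensional:
  assumes "N \<in> K" "N \<noteq> 0" "M \<in> K"
  shows "\<exists>r. M = r *\<^sub>R N"
proof -
  obtain c where c: "pairing N N c" using pairing_exists assms by blast
  obtain b where b: "pairing M N b" using pairing_exists assms by blast
  have "pr U ** M ** pr V = pr U ** ((b / c) *\<^sub>R N) ** pr V" if UV: "U \<in> P" "V \<in> P" for U V
  proof (cases "U = V")
    case True
    then show ?thesis using assms UV by (simp add: K_diagonal_block)
  next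
    case False
    have "b *\<^sub>R (pr U ** N ** pr V) = b *\<^sub>R (pr U ** (e ** N) ** pr V)"
      using assms(1) by (simp add: K_def)
    also have "\<dots> = (pr U ** M ** pr V ** N ** pr U) ** N ** pr V"
      using b UV False unfolding pairing_def by (simp add: matrix_mul_assoc)
    also have "\<dots> = pr U ** M ** (pr V ** N ** pr U ** N ** pr V)" by (simp add: matrix_mul_assoc)
    also have "\<dots> = c *\<^sub>R (pr U ** (M ** (pr V ** e)))"
      using c UV False unfolding pairing_def by (simp add: matrix_mul_assoc)
    also have "\<dots> = c *\<^sub>R (pr U ** (M ** e) ** pr V)"
      using UV by (simp add: pr_e) (simp add: matrix_mul_assoc)
    also have "\<dots> = c *\<^sub>R (pr U ** M ** pr V)" using K_mult_e[OF assms(3)] by simp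
    finally have "(1 / c) *\<^sub>R (b *\<^sub>R (pr U ** N ** pr V)) = pr U ** M ** pr V"
      using pairing_pos[OF assms(1,2) c] by simp
    then show ?thesis by simp
  qed
  then show ?thesis using matrix_eq_blocksI by blast
qed

text \<open>Scaling by \<open>1 / sqrt c\<close> makes the self-pairing 1. Since \<open>K\<close> is
  a line, passing through a third fibre multiplies a block by a constant \<open>b\<close>; it turns
  out that \<open>b * b = 1\<close>, so replacing \<open>N1\<close> by \<open>b *\<^sub>R N1\<close>
  removes the constant.\<close>

lemma normalized_exists:
  assumes "N \<in> K" "N \<noteq> 0"
  obtains N' where "N' \<in> K" "pairing N' N' 1"
    "\<And>U V W. U \<in> P \<Longrightarrow> V \<in> P \<Longrightarrow> W \<in> P \<Longrightarrow> U \<noteq> V \<Longrightarrow> V \<noteq> W \<Longrightarrow> U \<noteq> W \<Longrightarrow>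
      pr U ** N' ** pr V ** N' ** pr W = pr U ** N' ** pr W"
proof -
  obtain c where c: "pairing N N c" using pairing_exists assms by blast
  have cpos: "0 < c" using pairing_pos assms c by blast
  define N1 where "N1 = (1 / sqrt c) *\<^sub>R N"
  have N1: "N1 \<in> K" "N1 \<noteq> 0" using assms cpos by (simp_all add: N1_def K_scaleR)
  have pair: "pairing N1 N1 1"
    using c cpos unfolding pairing_def N1_def by (auto simp: field_simps)
  obtain X where X: "X \<in> \<A>" "e ** X = X" "\<And>U V W. U \<in> P \<Longrightarrow> V \<in> P \<Longrightarrow> W \<in> P \<Longrightarrow> U \<noteq> V \<Longrightarrow> V \<noteq> W \<Longrightarrow>
    pr U ** N1 ** pr V ** N1 ** pr W = pr U ** X ** pr W"
    using K_product[OF N1(1) N1(1)] by auto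
  obtain b where b: "X - bdiag X = b *\<^sub>R N1" using K_one_dimensional[OF N1 diff_bdiag_in_K[OF X(1,2)]] by blast
  have prod: "pr U ** N1 ** pr V ** N1 ** pr W = b *\<^sub>R (pr U ** N1 ** pr W)"
    if "U \<in> P" "V \<in> P" "W \<in> P" "U \<noteq> V" "V \<noteq> W" "U \<noteq> W" for U V W
  proof -
    have "pr U ** X ** pr W = pr U ** (X - bdiag X) ** pr W"
      using that by (simp add: matrix_distribs bdiag_block)
    then show ?thesis using X(3) that b by simp
  qed
  show ?thesis
  proof (cases "\<exists>U\<in>P. \<exists>V\<in>P. \<exists>W\<in>P. U \<noteq> V \<and> V \<noteq> W \<and> U \<noteq> W")
    case True
    then obtain U V W where UVW: "U \<in> P" "V \<in> P" "W \<in> P" "U \<noteq> V" "V \<noteq> W" "U \<noteq> W" by blast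
    \<comment> \<open>The walk through \<open>U\<close>, \<open>V\<close>, \<open>W\<close> and back
      to \<open>V\<close>: its last two steps cancel by the pairing, while shortening it twice by
      \<open>prod\<close> gives the factor \<open>b * b\<close>.\<close>
    have "pr U ** N1 ** pr V = pr U ** (N1 ** e) ** pr V" using K_mult_e N1 by simp
    also have "\<dots> = pr U ** N1 ** (pr V ** N1 ** pr W ** N1 ** pr V)"
      using pair UVW unfolding pairing_def by (simp add: pr_e) (simp add: matrix_mul_assoc)
    also have "\<dots> = (pr U ** N1 ** pr V ** N1 ** pr W) ** N1 ** pr V" by (simp add: matrix_mul_assoc)
    also have "\<dots> = (b * b) *\<^sub>R (pr U ** N1 ** pr V)" using prod UVW by simp
    finally have "(1 - b * b) *\<^sub>R (pr U ** N1 ** pr V) = 0" by (simp add: scaleR_left_diff_distrib)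
    moreover have "pr U ** N1 ** pr V \<noteq> 0"
    proof
      assume "pr U ** N1 ** pr V = 0"
      then have "pr U ** e = 0" using pair UVW unfolding pairing_def by (metis matrix_mul_zero(2) scaleR_one)
      then show False using trace_pr_pos[OF e_in e_idem e_nonzero UVW(1)] by simp
    qed
    ultimately have bb: "b * b = 1" by simp
    show ?thesis
    proof
      show "b *\<^sub>R N1 \<in> K" using N1 K_scaleR by blast
      show "pairing (b *\<^sub>R N1) (b *\<^sub>R N1) 1" using pair bb unfolding pairing_def by simp
      show "pr U ** (b *\<^sub>R N1) ** pr V ** (b *\<^sub>R N1) ** pr W = pr U ** (b *\<^sub>R N1) ** pr W"
        if "U \<in> P" "V \<in> P" "W \<in> P" "U \<noteq> V" "V \<noteq> W" "U \<noteq> W" for U V W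
        using prod[OF that] bb by simp
    qed
  next
    \<comment> \<open>With at most two fibres the triangle identity is vacuous, and either sign
      would do.\<close>
    case False
    then show ?thesis using that[OF N1(1) pair] by blast
  qed
qed

text \<open>For \<open>G = e + N\<close> the normalization says \<open>G ** pr V ** G = G\<close>
  for each fibre \<open>V\<close>, checked block by block according to which of \<open>U\<close>,
  \<open>V\<close>, \<open>W\<close> coincide. Summing over the \<open>w\<close> fibres gives the
  square.\<close>

lemma normalized_square:
  assumes "N \<in> K" "pairing N N 1"
    and tri: "\<And>U V W. U \<in> P \<Longrightarrow> V \<in> P \<Longrightarrow> W \<in> P \<Longrightarrow> U \<noteq> V \<Longrightarrow> V \<noteq> W \<Longrightarrow> U \<noteq> W \<Longrightarrow>
      pr U ** N ** pr V ** N ** pr W = pr U ** N ** pr W"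
  shows "(e + N) ** (e + N) = real w *\<^sub>R (e + N)"
proof -
  let ?G = "e + N"
  have diag: "pr U ** ?G ** pr U = pr U ** e" if "U \<in> P" for U
    using that assms(1) by (simp add: matrix_distribs e_block K_diagonal_block)
  have off: "pr U ** ?G ** pr V = pr U ** N ** pr V" if "U \<in> P" "V \<in> P" "U \<noteq> V" for U V
    using that by (simp add: matrix_distribs e_block_0)
  have "?G ** pr V ** ?G = ?G" if V: "V \<in> P" for V
  proof (rule matrix_eq_blocksI)
    fix U W assume UW: "U \<in> P" "W \<in> P"
    have split: "pr U ** (?G ** pr V ** ?G) ** pr W = (pr U ** ?G ** pr V) ** (pr V ** ?G ** pr W)"
      by (simp add: matrix_mul_assoc coord_proj_idem')
    consider "U = V" "V = W" | "U = V" "V \<noteq> W" | "U \<noteq> V" "V = W" | "U \<noteq> V" "V \<noteq> W" "U = W"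
      | "U \<noteq> V" "V \<noteq> W" "U \<noteq> W" by blast
    then have "(pr U ** ?G ** pr V) ** (pr V ** ?G ** pr W) = pr U ** ?G ** pr W"
    proof cases
      case 1
      have "(pr V ** e) ** (pr V ** e) = pr V ** (e ** e)"
        using V by (simp add: matrix_mul_assoc pr_e pr_e' coord_proj_idem')
      then show ?thesis using 1 V by (simp add: diag e_idem)
    next
      case 2
      have "(pr V ** e) ** (pr V ** N ** pr W) = pr V ** (e ** N) ** pr W"
        using V by (simp add: pr_e matrix_mul_assoc coord_proj_idem')
      then show ?thesis using 2 V UW assms(1) by (simp add: diag off K_def)
    next
      case 3
      have "(pr U ** N ** pr V) ** (pr V ** e) = pr U ** (N ** e) ** pr V"
        using V by (simp add: matrix_mul_assoc pr_e' coord_proj_idem')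
      then show ?thesis using 3 V UW K_mult_e[OF assms(1)] by (simp add: diag off)
    next
      case 4
      have "(pr W ** N ** pr V) ** (pr V ** N ** pr W) = pr W ** e"
        using 4 V UW assms(2) unfolding pairing_def by (simp add: matrix_mul_assoc coord_proj_idem')
      then show ?thesis using 4 V UW by (simp add: diag off)
    next
      case 5
      have "(pr U ** N ** pr V) ** (pr V ** N ** pr W) = pr U ** N ** pr W"
        using 5 V UW tri by (simp add: matrix_mul_assoc coord_proj_idem')
      then show ?thesis using 5 V UW by (simp add: off)
    qed
    then show "pr U ** (?G ** pr V ** ?G) ** pr W = pr U ** ?G ** pr W" using split by simp
  qed
  then have "(\<Sum>V\<in>P. ?G ** pr V ** ?G) = real w *\<^sub>R ?G"
    using card_P by (simp add: scaleR_conv_of_real flip: sum_constant_scaleR)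
  moreover have "(\<Sum>V\<in>P. ?G ** pr V ** ?G) = ?G ** ?G"
    by (simp add: sum_pr flip: matrix_mul_sum)
  ultimately show ?thesis by simp
qed

text \<open>The idempotent \<open>G = (e + N) / w\<close> lies below \<open>e\<close>, and together
  they span the ideal of \<open>e\<close>. So exactly two primitive idempotents lie below
  \<open>e\<close>, namely \<open>G\<close> and \<open>e - G\<close>.\<close>

lemma linked_pair_exists:
  assumes "k \<le> d" "e ** E k = E k" "bdiag (E k) \<noteq> E k"
  shows "\<exists>i\<le>d. \<exists>j\<le>d. i \<noteq> j \<and> k \<in> {i, j} \<and> bdiag (E i) = (1 / real w) *\<^sub>R (E i + E j)"
proof -
  have "E k - bdiag (E k) \<in> K" using diff_bdiag_in_K assms by simp
  moreover have "E k - bdiag (E k) \<noteq> 0" using assms(3) by auto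
  ultimately obtain N where N: "N \<in> K" "pairing N N 1"
    and tri: "\<And>U V W. U \<in> P \<Longrightarrow> V \<in> P \<Longrightarrow> W \<in> P \<Longrightarrow> U \<noteq> V \<Longrightarrow> V \<noteq> W \<Longrightarrow> U \<noteq> W \<Longrightarrow>
      pr U ** N ** pr V ** N ** pr W = pr U ** N ** pr W"
    using normalized_exists by blast
  have N0: "N \<noteq> 0"
  proof
    assume "N = 0"
    have "1 < card P" using card_P w_ge_2 by simp
    then obtain U V where UV: "U \<in> P" "V \<in> P" "U \<noteq> V"
      by (metis card_le_Suc0_iff_eq finite not_le One_nat_def)
    then have "pr U ** e = 0" using N(2) \<open>N = 0\<close> unfolding pairing_def by auto
    then show False using trace_pr_pos[OF e_in e_idem e_nonzero UV(1)] by simp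
  qed
  have N_in: "N \<in> \<A>" "e ** N = N" "bdiag N = 0" using N(1) by (auto simp: K_def)
  define G where "G = (1 / real w) *\<^sub>R (e + N)"
  have G: "G \<in> \<A>" unfolding G_def using N_in e_in by (intro \<A>_intros)
  have GG: "G ** G = G" using normalized_square[OF N tri] w_real by (simp add: G_def)
  have eG: "e ** G = G" using N_in by (simp add: G_def matrix_distribs e_idem)
  have bdiagG: "bdiag G = (1 / real w) *\<^sub>R e" using N_in by (simp add: G_def bdiag_linear bdiag_e)
  have c01: "coef j M = 0 \<or> coef j M = 1" if "M \<in> \<A>" "M ** M = M" "j \<le> d" for j M
    using coef_mult[OF that(1,1,3)] that(2) by (metis mult_cancel_right1 mult.commute)
  have ce: "coef j e = 0 \<or> coef j e = 1" and cG: "coef j G = 0 \<or> coef j G = 1" if "j \<le> d" for j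
    using c01[OF e_in e_idem that] c01[OF G GG that] by auto
  have sub: "coef j e = 1" if "j \<le> d" "coef j G = 1" for j
    using coef_mult[OF e_in G that(1)] that eG by simp
  \<comment> \<open>\<open>G\<close> is nonzero because \<open>bdiag G\<close> is a nonzero multiple
    of \<open>e\<close>.\<close>
  obtain i where i: "i \<le> d" "coef i G = 1"
  proof -
    have "\<exists>i\<le>d. coef i G \<noteq> 0"
    proof (rule ccontr)
      assume "\<not> ?thesis"
      then have "G = 0" using G by (intro \<A>_eqI) (auto simp: coef_0 \<A>_intros)
      then show False using bdiagG e_nonzero w_real by (simp add: bdiag_linear)
    qed
    then show ?thesis using cG that by blast
  qed
  \<comment> \<open>\<open>G\<close> differs from \<open>e\<close>: their block diagonal parts are
    \<open>e / w\<close> and \<open>e\<close>, and \<open>w\<close> is at least 2.\<close>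
  obtain j where j: "j \<le> d" "coef j G = 0" "coef j e = 1"
  proof -
    have "\<exists>j\<le>d. coef j G \<noteq> coef j e"
    proof (rule ccontr)
      assume "\<not> ?thesis"
      then have "G = e" using G e_in by (intro \<A>_eqI) auto
      then have "(1 - 1 / real w) *\<^sub>R e = 0" using bdiagG bdiag_e by (simp add: scaleR_left_diff_distrib)
      then show False using e_nonzero w_real by (simp add: field_simps)
    qed
    then show ?thesis using cG ce sub that by metis
  qed
  have span: "\<exists>a b. E h = a *\<^sub>R e + b *\<^sub>R G" if h: "h \<le> d" "coef h e = 1" for h
  proof -
    have eh: "e ** E h = E h" using mult_E[OF e_in h(1)] h(2) by simp
    obtain a where a: "bdiag (E h) = a *\<^sub>R e" using bdiag_multiple_e[OF E_in eh] h by blast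
    obtain b where b: "E h - bdiag (E h) = b *\<^sub>R N"
      using K_one_dimensional[OF N(1) N0 diff_bdiag_in_K[OF E_in eh]] h by blast
    have "N = real w *\<^sub>R G - e" using w_real by (simp add: G_def)
    moreover have "E h = a *\<^sub>R e + b *\<^sub>R N" using a b by (metis diff_eq_eq add.commute)
    ultimately have "E h = a *\<^sub>R e + b *\<^sub>R (real w *\<^sub>R G - e)" by simp
    then have "E h = (a - b) *\<^sub>R e + (b * real w) *\<^sub>R G" by (simp add: algebra_simps)
    then show ?thesis by blast
  qed
  \<comment> \<open>Evaluating \<open>E h = a e + b G\<close> at \<open>h\<close> and at
    \<open>h'\<close> gives the same value, so below \<open>e\<close> an index is determined by its
    coefficient in \<open>G\<close>.\<close>
  have eq: "h = h'" if "h \<le> d" "h' \<le> d" "coef h e = 1" "coef h' e = 1" "coef h G = coef h' G" for h h'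
  proof -
    obtain a b where "E h = a *\<^sub>R e + b *\<^sub>R G" using span[OF \<open>h \<le> d\<close> \<open>coef h e = 1\<close>] by blast
    then have "coef h (E h) = coef h' (E h)" using that by (simp add: coef_linear)
    then show ?thesis using that by (simp add: coef_E split: if_splits)
  qed
  have ij: "i \<noteq> j" using i j by auto
  have Gi: "coef h G = (if h = i then 1 else 0)" if "h \<le> d" for h
  proof -
    have "coef h G \<noteq> 1" if "h \<noteq> i"
      using eq[OF \<open>h \<le> d\<close> i(1)] sub[OF \<open>h \<le> d\<close>] sub[OF i] i(2) that by fastforce
    then show ?thesis using cG[OF that] i(2) by auto
  qed
  have ei: "coef h e = (if h = i \<or> h = j then 1 else 0)" if "h \<le> d" for h
  proof -
    have "coef h e \<noteq> 1" if "h \<noteq> i" "h \<noteq> j"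
      using eq[OF \<open>h \<le> d\<close> j(1)] Gi[OF \<open>h \<le> d\<close>] j(2,3) that by fastforce
    then show ?thesis using ce[OF that] sub[OF i] j(3) by auto
  qed
  have "G = E i" using G i by (intro \<A>_eqI) (auto simp: Gi coef_E)
  moreover have "e = E i + E j"
    using e_in i j ij by (intro \<A>_eqI) (auto simp: ei coef_E coef_add intro!: \<A>_intros)
  moreover have "k \<in> {i, j}"
  proof -
    have "coef k e *\<^sub>R E k = E k" using mult_E[OF e_in assms(1)] assms(2) by simp
    then have "coef k e = 1" using E_nonzero[OF assms(1)] by (metis scaleR_cancel_right scaleR_one)
    then show ?thesis using ei assms(1) by (auto split: if_splits)
  qed
  ultimately show ?thesis using bdiagG i j ij by blast
qed

end

section \<open>Linked idempotents\<close>

text \<open>The combinatorial part: \<open>L\<close> is a matching with oriented edges. One endpoint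
  of each edge goes to the front, its partner to the mirrored position \<open>d - j\<close>, and the
  unmatched indices to the middle.\<close>

lemma pairing_permutation:
  fixes L :: "nat \<Rightarrow> nat \<Rightarrow> bool"
  assumes L_le: "\<And>i j. L i j \<Longrightarrow> i \<le> d \<and> j \<le> d \<and> i \<noteq> j"
    and uniq1: "\<And>i j k. L i j \<Longrightarrow> L i k \<Longrightarrow> j = k"
    and uniq2: "\<And>i j k. L i k \<Longrightarrow> L j k \<Longrightarrow> i = j"
    and uniq3: "\<And>i j k. L i j \<Longrightarrow> L j k \<Longrightarrow> k = i"
    and L_0: "L 0 j0"
  obtains l \<sigma> where "1 \<le> l" "2 * l < d + 2" "\<sigma> permutes {..d}" "\<sigma> 0 = 0"
    "\<And>j. j < l \<Longrightarrow> L (\<sigma> j) (\<sigma> (d - j))"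
    "\<And>j k. l \<le> j \<Longrightarrow> j \<le> d - l \<Longrightarrow> \<not> L (\<sigma> j) k \<and> \<not> L k (\<sigma> j)"
proof -
  \<comment> \<open>The side condition breaks ties when \<open>L\<close> is symmetric, which happens for two fibres.\<close>
  define S where "S = {i. \<exists>j. L i j \<and> (L j i \<longrightarrow> i < j)}"
  define f where "f i = (SOME j. L i j)" for i
  define T where "T = {..d} - (S \<union> f ` S)"
  have f: "L i (f i)" if "i \<in> S" for i
    using that unfolding S_def f_def by (auto intro: someI)
  have f_eq: "f i = j" if "L i j" for i j
    using uniq1 that unfolding f_def by (metis someI)
  have S_sub: "S \<subseteq> {..d}" "f ` S \<subseteq> {..d}" using f L_le by (simp_all add: image_subset_iff subset_iff) blast+
  have fin: "finite S" "finite T" using finite_subset[OF S_sub(1)] by (auto simp: T_def)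
  \<comment> \<open>The tie-break cannot exclude 0, which is smaller than its partner.\<close>
  have S0: "0 \<in> S" unfolding S_def using L_0 L_le by (metis (mono_tags, lifting) mem_Collect_eq neq0_conv)
  have inj: "inj_on f S" using f uniq2 by (intro inj_onI) metis
  have disj: "S \<inter> f ` S = {}"
  proof -
    have False if "i \<in> S" "i' \<in> S" "i = f i'" for i i'
    proof -
      have "L i' i" "L i (f i)" using f that by auto
      then have "f i = i'" using uniq3 by blast
      then have "L i i'" using \<open>L i (f i)\<close> by simp
      have "i < i'" using \<open>i \<in> S\<close> \<open>L i i'\<close> \<open>L i' i\<close> uniq1 unfolding S_def by blast
      moreover have "i' < i" using \<open>i' \<in> S\<close> \<open>L i i'\<close> \<open>L i' i\<close> uniq1 unfolding S_def by blast
      ultimately show False by simp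
    qed
    then show ?thesis by blast
  qed
  have T1: "\<not> L k j" if "k \<in> T" for k j
  proof
    assume "L k j"
    moreover have "k \<notin> S" using that by (simp add: T_def)
    ultimately have "L j k" "\<not> k < j" unfolding S_def by auto
    then have "j < k" using L_le by (metis linorder_neqE_nat)
    then have "j \<in> S" using \<open>L j k\<close> unfolding S_def by blast
    then have "k \<in> f ` S" using f_eq[OF \<open>L j k\<close>] by blast
    then show False using that by (simp add: T_def)
  qed
  have T2: "\<not> L i k" if "k \<in> T" for k i
  proof
    assume "L i k"
    have "i \<notin> S" using f_eq[OF \<open>L i k\<close>] that by (auto simp: T_def)
    then have "L k i" using \<open>L i k\<close> unfolding S_def by blast
    then show False using T1 that by blast
  qed
  define l where "l = card S"
  have l1: "1 \<le> l" using S0 fin by (metis One_nat_def Suc_leI card_gt_0_iff empty_iff l_def)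
  have cardU: "card (S \<union> f ` S) = 2 * l"
    using card_Un_disjoint[OF fin(1) _ disj] card_image[OF inj] fin by (simp add: l_def)
  have "card (S \<union> f ` S) \<le> card {..d}" using S_sub by (intro card_mono) auto
  then have l2: "2 * l \<le> d + 1" using cardU by simp
  have cardT: "card T = d + 1 - 2 * l"
    unfolding T_def using S_sub cardU fin by (subst card_Diff_subset) auto
  have g: "bij_betw (enumerate S) {..<l} S" unfolding l_def using finite_bij_enumerate[OF fin(1)] .
  have t: "bij_betw (enumerate T) {..<d + 1 - 2 * l} T"
    using finite_bij_enumerate[OF fin(2)] cardT by simp
  \<comment> \<open>Enumerating \<open>S\<close> in increasing order puts 0 first. Beyond
    \<open>d\<close> the map is the identity, as \<open>permutes\<close> demands.\<close>
  define \<sigma> where "\<sigma> j = (if j < l then enumerate S j else if j < d + 1 - l then enumerate T (j - l)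
    else if j \<le> d then f (enumerate S (d - j)) else j)" for j
  have b1: "bij_betw \<sigma> {..<l} S"
    using g by (rule bij_betw_cong[THEN iffD1, rotated]) (simp add: \<sigma>_def)
  have "bij_betw (\<lambda>j. j - l) {l..<d + 1 - l} {..<d + 1 - 2 * l}"
    by (rule bij_betw_byWitness[where f' = "\<lambda>j. j + l"]) auto
  then have "bij_betw (enumerate T \<circ> (\<lambda>j. j - l)) {l..<d + 1 - l} T" using t by (rule bij_betw_trans)
  then have b2: "bij_betw \<sigma> {l..<d + 1 - l} T"
    by (rule bij_betw_cong[THEN iffD1, rotated]) (simp add: \<sigma>_def)
  have "bij_betw (\<lambda>j. d - j) {d + 1 - l..d} {..<l}"
    using l1 l2 by (intro bij_betw_byWitness[where f' = "\<lambda>j. d - j"]) auto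
  then have "bij_betw (f \<circ> (enumerate S \<circ> (\<lambda>j. d - j))) {d + 1 - l..d} (f ` S)"
    using g inj by (meson bij_betw_trans inj_on_imp_bij_betw)
  then have b3: "bij_betw \<sigma> {d + 1 - l..d} (f ` S)"
    by (rule bij_betw_cong[THEN iffD1, rotated]) (use l2 in \<open>auto simp: \<sigma>_def\<close>)
  have "bij_betw \<sigma> ({..<l} \<union> {d + 1 - l..d} \<union> {l..<d + 1 - l}) (S \<union> f ` S \<union> T)"
    using disj by (intro bij_betw_combine b1 b2 b3) (auto simp: T_def)
  moreover have "{..<l} \<union> {d + 1 - l..d} \<union> {l..<d + 1 - l} = {..d}" using l1 l2 by auto
  moreover have "S \<union> f ` S \<union> T = {..d}" using S_sub by (auto simp: T_def)
  ultimately have "bij_betw \<sigma> {..d} {..d}" by simp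
  then have perm: "\<sigma> permutes {..d}"
    by (rule bij_imp_permutes) (use l2 in \<open>auto simp: \<sigma>_def\<close>)
  show ?thesis
  proof
    show "1 \<le> l" "2 * l < d + 2" using l1 l2 by auto
    show "\<sigma> permutes {..d}" by (rule perm)
    show "\<sigma> 0 = 0" using l1 S0 by (simp add: \<sigma>_def enumerate_0 Least_eq_0)
    show "L (\<sigma> j) (\<sigma> (d - j))" if "j < l" for j
    proof -
      have "\<sigma> j = enumerate S j" "\<sigma> (d - j) = f (enumerate S j)"
        using that l1 l2 by (auto simp: \<sigma>_def)
      moreover have "enumerate S j \<in> S" using that g by (auto simp: bij_betw_def)
      ultimately show ?thesis using f by simp
    qed
    show "\<not> L (\<sigma> j) k \<and> \<not> L k (\<sigma> j)" if "l \<le> j" "j \<le> d - l" for j k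
    proof -
      have "j \<in> {l..<d + 1 - l}" using that l1 l2 by auto
      then have "\<sigma> j \<in> T" using b2 by (auto simp: bij_betw_def)
      then show ?thesis using T1 T2 by blast
    qed
  qed
qed

context imprimitive_scheme
begin

text \<open>The order of the pair matters: comparing traces shows that \<open>E j\<close> has
  \<open>w - 1\<close> times the trace of \<open>E i\<close>, so both orders can occur only for
  \<open>w = 2\<close>.\<close>

definition linked :: "nat \<Rightarrow> nat \<Rightarrow> bool" where
  "linked i j \<longleftrightarrow> i \<le> d \<and> j \<le> d \<and> i \<noteq> j \<and> bdiag (E i) = (1 / real w) *\<^sub>R (E i + E j)"

text \<open>Applying the idempotent map \<open>bdiag\<close> to the defining identity shows that it
  fixes \<open>E i + E j\<close>.\<close>

lemma linked_bdiag_second: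
  assumes "linked i j"
  shows "bdiag (E j) = (1 - 1 / real w) *\<^sub>R (E i + E j)"
proof -
  have D: "bdiag (E i) = (1 / real w) *\<^sub>R (E i + E j)" using assms by (simp add: linked_def)
  have "(1 / real w) *\<^sub>R (bdiag (E i) + bdiag (E j)) = (1 / real w) *\<^sub>R (E i + E j)"
    using bdiag_bdiag[of "E i"] D by (metis bdiag_linear(1,3))
  then have "bdiag (E i) + bdiag (E j) = E i + E j" using w_real by simp
  then show ?thesis using D by (simp add: scaleR_left_diff_distrib algebra_simps)
qed

lemma linked_bdiag_sum: "linked i j \<Longrightarrow> bdiag (E i + E j) = E i + E j"
  using linked_bdiag_second[of i j] by (simp add: linked_def bdiag_linear flip: scaleR_left_distrib)

lemma linked_coef:
  assumes "linked i j" "k \<le> d"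
  shows "coef k (bdiag (E i)) = (if k = i \<or> k = j then 1 / real w else 0)"
    "coef k (bdiag (E j)) = (if k = i \<or> k = j then 1 - 1 / real w else 0)"
  using assms unfolding linked_bdiag_second[OF assms(1)] linked_def
  by (auto simp: coef_linear coef_E)

lemma inverse_w: "1 / real w \<noteq> 0" "1 - 1 / real w \<noteq> 0"
  using w_real by (auto simp: field_simps)

lemma linked_le: "linked i j \<Longrightarrow> i \<le> d \<and> j \<le> d \<and> i \<noteq> j"
  by (simp add: linked_def)

text \<open>The support of \<open>bdiag (E i)\<close> is \<open>{i, j}\<close>, since
  \<open>1 / w\<close> and \<open>1 - 1 / w\<close> are nonzero. This and the next two lemmas are
  the matching laws that \<open>pairing_permutation\<close> asks for.\<close>

lemma linked_unique_right: "linked i j \<Longrightarrow> linked i k \<Longrightarrow> j = k"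
  using linked_coef(1)[of i j j] linked_coef(1)[of i k j] linked_le inverse_w by (metis (full_types))

lemma linked_unique_left: "linked i k \<Longrightarrow> linked j k \<Longrightarrow> i = j"
  using linked_coef(2)[of i k i] linked_coef(2)[of j k i] linked_le inverse_w by (metis (full_types))

lemma linked_back: "linked i j \<Longrightarrow> linked j k \<Longrightarrow> k = i"
  using linked_coef(2)[of i j k] linked_coef(1)[of j k k] linked_le inverse_w by (metis (full_types))

section \<open>Linked pairs in a uniform scheme\<close>

lemma uniform_trichotomy:
  assumes "uniform_scheme d R P I" "k \<le> d"
  shows "bdiag (E k) = E k \<or> (\<exists>j. linked k j) \<or> (\<exists>i. linked i k)"
proof (cases "bdiag (E k) = E k")
  case False
  obtain e where e: "e \<in> \<A>" "bdiag e = e" "e ** e = e" "e ** E k = E k"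
    "\<And>X. X \<in> \<A> \<Longrightarrow> bdiag X = X \<Longrightarrow> \<exists>c. e ** X = c *\<^sub>R e"
    using bdiag_fixed_idempotent_exists[OF assms(2)] by blast
  have "e \<noteq> 0" using e(4) E_nonzero[OF assms(2)] by auto
  then interpret uniform_idempotent R E d P w n I J e
    using e assms(1) by unfold_locales auto
  show ?thesis using linked_pair_exists[OF assms(2) e(4) False] by (auto simp: linked_def)
qed simp

lemma coef_bdiag_E_0: "k \<le> d \<Longrightarrow> coef k (bdiag (E 0)) = (if k \<in> J then 1 / real w else 0)"
proof -
  assume k: "k \<le> d"
  have "bdiag (E 0) = (1 / real CARD('x)) *\<^sub>R fibre_matrix P"
    by (simp add: E_0 bdiag_def hadamard_def all_ones_def vec_eq_iff)
  then show ?thesis using k n_pos by (simp add: coef_scaleR coef_fibre_matrix card_UNIV_eq)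
qed

text \<open>\<open>bdiag (E 0)\<close> is a multiple of the fibre matrix, so \<open>J\<close> is its
  support. The trichotomy at 0 then makes \<open>J\<close> a linked pair, as \<open>J\<close> is not
  \<open>{0}\<close>.\<close>

lemma uniform_J:
  assumes "uniform_scheme d R P I"
  shows "\<exists>j. linked 0 j \<and> J = {0, j}"
proof -
  have J: "J = {k. k \<le> d \<and> coef k (bdiag (E 0)) \<noteq> 0}"
    using J_sub coef_bdiag_E_0 w_real by (auto split: if_splits)
  consider "bdiag (E 0) = E 0" | j where "linked 0 j" | i where "linked i 0"
    using uniform_trichotomy[OF assms, of 0] by blast
  then show ?thesis
  proof cases
    case 1
    then have "J = {0}" unfolding J by (auto simp: coef_E split: if_splits)
    then show ?thesis using J_nontrivial by simp
  next
    case (2 j)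
    then have "J = {0, j}" unfolding J using linked_le[OF 2] linked_coef(1)[OF 2] inverse_w by (auto split: if_splits)
    then show ?thesis using 2 by blast
  next
    case (3 i)
    then have J0: "J = {0, i}" unfolding J using linked_le[OF 3] linked_coef(2)[OF 3] inverse_w by (auto split: if_splits)
    \<comment> \<open>Computing the coefficient of \<open>E 0\<close> in \<open>bdiag (E 0)\<close>
      in two ways shows \<open>w = 2\<close>, where links can be reversed.\<close>
    have "1 - 1 / real w = 1 / real w"
      using linked_coef(2)[OF 3, of 0] coef_bdiag_E_0[of 0] zero_in_J by simp
    then have "bdiag (E 0) = (1 / real w) *\<^sub>R (E 0 + E i)"
      using linked_bdiag_second[OF 3] by (metis add.commute)
    then have "linked 0 i" using linked_le[OF 3] unfolding linked_def by simp
    then show ?thesis using J0 by blast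
  qed
qed

text \<open>For \<open>J = {0, d}\<close> and \<open>0 < d\<close> this is
  \<open>sim_star d E J\<close>, as established inside \<open>Q_Higman_wrt_iff\<close>.\<close>

definition sim :: "(nat \<times> nat) set" where
  "sim = {(i, j). i \<le> d \<and> j \<le> d \<and> (i = j \<or> coef i (bdiag (E j)) \<noteq> 0)}"

lemma sim_Image:
  assumes "i \<le> d"
  shows "sim `` {i} = insert i {j. j \<le> d \<and> coef j (bdiag (E i)) \<noteq> 0}"
proof -
  have "coef i (bdiag (E j)) = 0 \<longleftrightarrow> coef j (bdiag (E i)) = 0" if "j \<le> d" for j
    using coef_bdiag_E_symmetric[OF assms that] trace_E_pos[OF assms] trace_E_pos[OF that]
    by (metis less_irrefl mult_eq_0_iff)
  then show ?thesis using assms by (auto simp: sim_def)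
qed

lemma linked_sim_Image:
  assumes "linked i j"
  shows "sim `` {i} = {i, j}" "sim `` {j} = {i, j}"
  using linked_le[OF assms] inverse_w by (auto simp: sim_Image linked_coef[OF assms] split: if_splits)

lemma fixed_sim_Image: "i \<le> d \<Longrightarrow> bdiag (E i) = E i \<Longrightarrow> sim `` {i} = {i}"
  by (auto simp: sim_Image coef_E split: if_splits)

lemma Q_Higman_wrt_if_linked:
  assumes J: "J = {0, d}" and d: "0 < d" and l: "2 * l < d + 2" "1 \<le> l"
    and link: "\<And>j. j < l \<Longrightarrow> linked j (d - j)"
    and fixed: "\<And>j. l \<le> j \<Longrightarrow> j \<le> d - l \<Longrightarrow> bdiag (E j) = E j"
  shows "Q_Higman_wrt d E J l"
proof -
  have mid: "sim `` {j} = {j}" if "l \<le> j" "j \<le> d - l" for j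
    using fixed_sim_Image fixed that by simp
  have low: "sim `` {j} = {j, d - j}" "sim `` {d - j} = {j, d - j}" if "j < l" for j
    using linked_sim_Image[OF link[OF that]] .
  have "{..d} // sim = {{j, d - j} |j. j < l} \<union> {{j} |j. l \<le> j \<and> j \<le> d - l}" (is "?Q = ?C")
  proof
    show "?Q \<subseteq> ?C"
    proof
      fix X assume "X \<in> ?Q"
      then obtain i where i: "i \<le> d" "X = sim `` {i}" by (auto simp: quotient_def)
      consider "i < l" | "l \<le> i" "i \<le> d - l" | "d - l < i" by linarith
      then show "X \<in> ?C"
      proof cases
        case 1
        then show ?thesis using i low by blast
      next
        case 2
        then show ?thesis using i mid by blast
      next
        case 3
        then have "d - i < l" "d - (d - i) = i" using i l by auto
        then have "X = {d - i, d - (d - i)}" using i low(2)[of "d - i"] by simp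
        then show ?thesis using \<open>d - i < l\<close> by blast
      qed
    qed
    show "?C \<subseteq> ?Q"
    proof
      fix X assume "X \<in> ?C"
      then consider j where "j < l" "X = {j, d - j}" | j where "l \<le> j" "j \<le> d - l" "X = {j}" by blast
      then show "X \<in> ?Q"
      proof cases
        case (1 j)
        then have "X = sim `` {j}" "j \<le> d" using low l by auto
        then show ?thesis by (auto simp: quotient_def)
      next
        case (2 j)
        then have "X = sim `` {j}" "j \<le> d" using mid by auto
        then show ?thesis by (auto simp: quotient_def)
      qed
    qed
  qed
  moreover have "\<forall>j<l. coef j (bdiag (E j)) = 1 / real w"
    using linked_coef(1)[OF link] linked_le[OF link] by auto
  ultimately show ?thesis using Q_Higman_wrt_iff[OF J d l(1)] unfolding sim_def by blast
qed

text \<open>Allows statements proved for the given ordering to be applied to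
  \<open>E \<circ> \<sigma>\<close>, as the definition of \<open>Q_Higman\<close> requires.\<close>

lemma reorder:
  assumes "\<sigma> permutes {..d}" "\<sigma> 0 = 0"
  shows "imprimitive_scheme R (E \<circ> \<sigma>) d P w n I {j. j \<le> d \<and> \<sigma> j \<in> J}"
proof
  let ?J = "{j. j \<le> d \<and> \<sigma> j \<in> J}"
  have bij: "bij_betw \<sigma> {..d} {..d}" using assms(1) by (rule permutes_imp_bij)
  show "assoc_scheme d R" by (rule scheme)
  have "bij_betw E {..d} {M. primitive_idempotent_in \<A> M}"
    using ordering by (simp add: idempotent_ordering_def)
  then show "idempotent_ordering d R (E \<circ> \<sigma>)"
    unfolding idempotent_ordering_def using bij_betw_trans[OF bij] E_0 assms(2) by simp
  have img: "\<sigma> ` ?J = J"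
  proof -
    have "j \<in> \<sigma> ` ?J" if "j \<in> J" for j
    proof -
      have "j \<in> \<sigma> ` {..d}" using that J_sub bij by (auto simp: bij_betw_def)
      then show ?thesis using that by auto
    qed
    then show ?thesis by auto
  qed
  have inj: "inj_on \<sigma> ?J" using bij by (auto simp: bij_betw_def inj_on_def)
  have sum: "(\<Sum>j\<in>?J. (E \<circ> \<sigma>) j) = (\<Sum>j\<in>J. E j)"
    using sum.reindex[OF inj, of E] img by simp
  have "{0} \<subset> ?J"
  proof -
    have "0 \<in> ?J" using assms(2) zero_in_J by simp
    moreover have "?J \<noteq> {0}" using img assms(2) J_nontrivial by force
    ultimately show ?thesis by auto
  qed
  moreover have "?J \<subset> {..d}"
  proof -
    have "?J \<noteq> {..d}" using img bij system unfolding bij_betw_def imprimitivity_system_def by auto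
    then show ?thesis by auto
  qed
  ultimately show "imprimitivity_system d R (E \<circ> \<sigma>) P w n I ?J"
    using system sum unfolding imprimitivity_system_def by simp
qed

theorem uniform_imp_Q_Higman:
  assumes "uniform_scheme d R P I"
  shows "Q_Higman d E J"
proof -
  obtain j0 where j0: "linked 0 j0" "J = {0, j0}" using uniform_J[OF assms] by blast
  obtain l \<sigma> where l: "1 \<le> l" "2 * l < d + 2" and \<sigma>: "\<sigma> permutes {..d}" "\<sigma> 0 = 0"
    and link: "\<And>j. j < l \<Longrightarrow> linked (\<sigma> j) (\<sigma> (d - j))"
    and unlinked: "\<And>j k. l \<le> j \<Longrightarrow> j \<le> d - l \<Longrightarrow> \<not> linked (\<sigma> j) k \<and> \<not> linked k (\<sigma> j)"
    by (rule pairing_permutation[of linked d j0])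
      (erule linked_le, erule (1) linked_unique_right, erule (1) linked_unique_left,
       erule (1) linked_back, rule j0(1), blast)
  let ?J = "{j. j \<le> d \<and> \<sigma> j \<in> J}"
  \<comment> \<open>\<open>bdiag\<close> involves only the fibres, so it is the same map for both
    orderings.\<close>
  interpret S: imprimitive_scheme R "E \<circ> \<sigma>" d P w n I ?J using reorder[OF \<sigma>] .
  have d: "0 < d" using linked_le[OF j0(1)] by auto
  have inj: "\<sigma> i = \<sigma> j \<longleftrightarrow> i = j" for i j using permutes_inj[OF \<sigma>(1)] by (auto dest: injD)
  have "\<sigma> d = j0" using link[of 0] l \<sigma>(2) linked_unique_right[OF j0(1)] by simp
  then have "J = {\<sigma> 0, \<sigma> d}" using j0 \<sigma> by simp
  then have J: "?J = {0, d}" by (auto simp: inj)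
  have "S.linked j (d - j)" if "j < l" for j
  proof -
    have "j \<noteq> d - j" "j \<le> d" using that l by auto
    then show ?thesis using link[OF that] unfolding linked_def S.linked_def by simp
  qed
  moreover have "bdiag ((E \<circ> \<sigma>) j) = (E \<circ> \<sigma>) j" if "l \<le> j" "j \<le> d - l" for j
  proof -
    have "\<sigma> j \<le> d" using permutes_in_image[OF \<sigma>(1), of j] that by auto
    then show ?thesis using uniform_trichotomy[OF assms] unlinked that by auto
  qed
  ultimately have "Q_Higman_wrt d (E \<circ> \<sigma>) ?J l"
    using S.Q_Higman_wrt_if_linked[OF J d l(2,1)] by blast
  then show ?thesis unfolding Q_Higman_def using l \<sigma> by blast
qed

end

section \<open>From Q-Higman to uniform\<close>

context imprimitive_scheme
begin

text \<open>The class of \<open>j\<close> bounds the support of \<open>bdiag (E j)\<close>. Trace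
  preservation, self-adjointness and idempotence of \<open>bdiag\<close> then determine the unknown
  coefficients.\<close>

lemma linked_if_Q_Higman_wrt:
  assumes Q: "Q_Higman_wrt d E J l" and l: "1 \<le> l" "2 * l < d + 2"
  shows "\<And>j. j < l \<Longrightarrow> linked j (d - j)"
    and "\<And>j. l \<le> j \<Longrightarrow> j \<le> d - l \<Longrightarrow> bdiag (E j) = E j"
proof -
  have J: "J = {0, d}" using Q by (simp add: Q_Higman_wrt_def)
  have d: "0 < d" using J J_nontrivial by auto
  have quot: "{..d} // sim = {{j, d - j} |j. j < l} \<union> {{j} |j. l \<le> j \<and> j \<le> d - l}"
    and diag: "\<And>j. j < l \<Longrightarrow> coef j (bdiag (E j)) = 1 / real w"
    using Q Q_Higman_wrt_iff[OF J d l(2)] unfolding sim_def by blast+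
  have classes: thesis if "i \<le> d"
    "\<And>k. k < l \<Longrightarrow> i \<in> {k, d - k} \<Longrightarrow> sim `` {i} = {k, d - k} \<Longrightarrow> thesis"
    "\<And>k. l \<le> k \<Longrightarrow> k \<le> d - l \<Longrightarrow> i = k \<Longrightarrow> sim `` {i} = {k} \<Longrightarrow> thesis" for i thesis
  proof -
    have "sim `` {i} \<in> {..d} // sim" using that(1) by (auto simp: quotient_def)
    moreover have "i \<in> sim `` {i}" using that(1) by (simp add: sim_Image)
    ultimately show ?thesis using that(2,3) unfolding quot by blast
  qed
  have coef0: "coef k (bdiag (E i)) = 0" if "i \<le> d" "k \<le> d" "k \<notin> sim `` {i}" for i k
    using that by (auto simp: sim_Image)
  show "linked j (d - j)" if j: "j < l" for j
  proof -
    let ?i = "d - j"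
    \<comment> \<open>The bound on \<open>l\<close> gives \<open>j + k < d\<close> for all
      \<open>j, k < l\<close>, so low indices never meet mirrored ones.\<close>
    have le: "j \<le> d" "?i \<le> d" "j \<noteq> ?i" using j l by auto
    have s1: "sim `` {j} = {j, ?i}" 
    proof (rule classes[OF le(1)])
      fix k assume k: "k < l" "j \<in> {k, d - k}" "sim `` {j} = {k, d - k}"
      then have "k = j" using j l le by auto
      then show ?thesis using k(3) by simp
    qed (use j l in auto)
    have s2: "sim `` {?i} = {j, ?i}" 
    proof (rule classes[OF le(2)])
      fix k assume k: "k < l" "?i \<in> {k, d - k}" "sim `` {?i} = {k, d - k}"
      then have "k = j" using j l le by auto
      then show ?thesis using k(3) by simp
    qed (use j l in auto)
    define s t u where "s = coef ?i (bdiag (E j))" and "t = coef j (bdiag (E ?i))" and "u = coef ?i (bdiag (E ?i))"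
    have D1: "bdiag (E j) = (1 / real w) *\<^sub>R E j + s *\<^sub>R E ?i"
    proof (rule \<A>_eqI)
      fix k assume "k \<le> d"
      then show "coef k (bdiag (E j)) = coef k ((1 / real w) *\<^sub>R E j + s *\<^sub>R E ?i)"
        using coef0[OF le(1), of k] le diag[OF j] unfolding s1 s_def
        by (cases "k = j"; cases "k = ?i") (simp_all add: coef_linear coef_E)
    qed (use le in \<open>auto intro!: bdiag_in \<A>_intros\<close>)
    have D2: "bdiag (E ?i) = t *\<^sub>R E j + u *\<^sub>R E ?i"
    proof (rule \<A>_eqI)
      fix k assume "k \<le> d"
      then show "coef k (bdiag (E ?i)) = coef k (t *\<^sub>R E j + u *\<^sub>R E ?i)"
        using coef0[OF le(2), of k] le unfolding s2 t_def u_def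
        by (cases "k = j"; cases "k = ?i") (simp_all add: coef_linear coef_E)
    qed (use le in \<open>auto intro!: bdiag_in \<A>_intros\<close>)
    have tr: "trace (E j) = trace (E j) / real w + s * trace (E ?i)"
      using trace_bdiag[of "E j"] unfolding D1 by (simp add: trace_add trace_scaleR)
    have "s * trace (E ?i) = t * trace (E j)"
      using coef_bdiag_E_symmetric[OF le(1,2)] by (simp add: s_def t_def)
    then have "(t - (1 - 1 / real w)) * trace (E j) = 0" using tr by (simp add: algebra_simps)
    then have t: "t = 1 - 1 / real w" using trace_E_pos[OF le(1)] by simp
    \<comment> \<open>Comparing \<open>bdiag (bdiag (E j))\<close> with \<open>bdiag (E j)\<close>
      at \<open>j\<close> gives \<open>s * t = (1 / w) * (1 - 1 / w)\<close>.\<close>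
    have "coef j (bdiag (bdiag (E j))) = 1 / real w" using diag[OF j] by simp
    moreover have "coef j (bdiag (bdiag (E j))) = (1 / real w) * (1 / real w) + s * t"
      by (subst D1) (simp add: bdiag_linear coef_linear diag[OF j] t_def)
    ultimately have "(s - 1 / real w) * t = 0" by (simp add: t algebra_simps)
    then have "s = 1 / real w" using t inverse_w(2) by (metis eq_iff_diff_eq_0 mult_eq_0_iff)
    then show ?thesis using le D1 unfolding linked_def by (simp add: scaleR_right_distrib)
  qed
  show "bdiag (E j) = E j" if j: "l \<le> j" "j \<le> d - l" for j
  proof -
    have le: "j \<le> d" using j by auto
    have s1: "sim `` {j} = {j}" 
      by (rule classes[OF le]) (use j l in auto)
    have D: "bdiag (E j) = coef j (bdiag (E j)) *\<^sub>R E j"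
    proof (rule \<A>_eqI)
      fix k assume "k \<le> d"
      then show "coef k (bdiag (E j)) = coef k (coef j (bdiag (E j)) *\<^sub>R E j)"
        using coef0[OF le, of k] le unfolding s1 by (cases "k = j") (simp_all add: coef_linear coef_E)
    qed (use le in \<open>auto intro!: bdiag_in \<A>_intros\<close>)
    have "trace (E j) = coef j (bdiag (E j)) * trace (E j)"
      using trace_bdiag[of "E j"] D by (metis trace_scaleR)
    then have "coef j (bdiag (E j)) = 1" using trace_E_pos[OF le] by simp
    then show ?thesis using D by simp
  qed
qed

text \<open>The matrix \<open>w E pr\<^sub>V E\<close> is an idempotent below \<open>E\<close> of the same trace.\<close>

lemma linked_E_pr_E:
  assumes "linked i j" "V \<in> P"
  shows "E i ** pr V ** E i = (1 / real w) *\<^sub>R E i"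
proof -
  let ?e = "E i + E j"
  have le: "i \<le> d" "j \<le> d" "i \<noteq> j" using linked_le[OF assms(1)] by auto
  have EE: "E i ** E i = E i" using E_idem le by simp
  have EE': "M ** E i ** E i = M ** E i" for M :: "real ^ 'x ^ 'x"
    using EE by (simp flip: matrix_mul_assoc)
  have eE: "?e ** E i = E i" using le by (simp add: matrix_distribs E_idem E_orthogonal)
  have "pr V ** bdiag (E i) ** pr V = pr V ** E i ** pr V" using bdiag_block[OF assms(2,2)] by simp
  then have "pr V ** E i ** pr V = (1 / real w) *\<^sub>R (pr V ** ?e ** pr V)"
    using assms(1) by (simp add: linked_def)
  also have "pr V ** ?e ** pr V = pr V ** ?e"
    using bdiag_fixed_commute[OF linked_bdiag_sum[OF assms(1)] assms(2)] by (simp add: coord_proj_idem')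
  finally have blk: "pr V ** E i ** pr V = (1 / real w) *\<^sub>R (pr V ** ?e)" .
  define T where "T = real w *\<^sub>R (E i ** pr V ** E i)"
  have TE: "T ** E i = T" "E i ** T = T"
    by (simp_all add: T_def EE' EE matrix_mul_assoc)
  have "T ** T = (real w * real w) *\<^sub>R (E i ** (pr V ** E i ** pr V) ** E i)"
    by (simp add: T_def matrix_mul_assoc EE')
  also have "\<dots> = real w *\<^sub>R (E i ** pr V ** (?e ** E i))"
    unfolding blk using w_real by (simp add: matrix_mul_assoc)
  finally have TT: "T ** T = T" unfolding eE T_def .
  have sym: "transpose (E i) = E i" using \<A>_symmetric E_in le by blast
  \<comment> \<open>\<open>H\<close> is a symmetric idempotent, so its trace is its squared
    Frobenius norm, and trace zero forces \<open>H = 0\<close>.\<close>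
  define H where "H = E i - T"
  have "transpose T = T"
    by (simp add: T_def transpose_scaleR matrix_transpose_mul sym transpose_coord_proj matrix_mul_assoc)
  then have "transpose H = H"
    using sym by (simp add: H_def transpose_def vec_eq_iff)
  moreover have "H ** H = H" by (simp add: H_def matrix_distribs EE TE TT)
  moreover have "trace T = trace (E i)"
  proof -
    have "trace (E i ** (pr V ** E i)) = trace (pr V ** E i ** E i)" by (rule trace_mul_sym)
    then have "trace (E i ** pr V ** E i) = trace (pr V ** E i)" by (simp add: matrix_mul_assoc EE')
    then show ?thesis using trace_pr_mult[OF E_in[OF le(1)] assms(2)] by (simp add: T_def trace_scaleR)
  qed
  ultimately have "trace (H ** transpose H) = 0" by (simp add: H_def trace_sub)
  then have "H = 0" by (simp only: trace_mult_transpose_eq_0_iff)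
  then have "E i = real w *\<^sub>R (E i ** pr V ** E i)" by (simp add: H_def T_def)
  then show ?thesis using w_real
    by (metis divide_self_if mult.left_neutral scaleR_one scaleR_scaleR times_divide_eq_left)
qed

text \<open>\<open>E i + E j\<close> commutes with \<open>pr V\<close>, fixes \<open>E i\<close> and
  annihilates \<open>E k\<close>.\<close>

lemma linked_E_pr_E_orthogonal:
  assumes "linked i j" "V \<in> P" "k \<le> d" "k \<noteq> i" "k \<noteq> j"
  shows "E i ** pr V ** E k = 0"
proof -
  let ?e = "E i + E j"
  have le: "i \<le> d" "j \<le> d" "i \<noteq> j" using linked_le[OF assms(1)] by auto
  have "E i ** ?e = E i" using le by (simp add: matrix_distribs E_idem E_orthogonal)
  then have "E i ** pr V ** E k = E i ** (?e ** pr V) ** E k" by (simp add: matrix_mul_assoc)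
  also have "\<dots> = E i ** pr V ** (?e ** E k)"
    using bdiag_fixed_commute[OF linked_bdiag_sum[OF assms(1)] assms(2)] by (metis matrix_mul_assoc)
  also have "?e ** E k = 0" using le assms by (simp add: matrix_distribs E_orthogonal)
  finally show ?thesis by simp
qed

lemma bdiag_adj:
  assumes "i \<le> d"
  shows "bdiag (adj (R i)) = (if i \<in> I then adj (R i) else 0)"
  using mem_I_iff[OF assms] by (auto simp: bdiag_def hadamard_def adj_def fibre_matrix_def vec_eq_iff)

lemma rel_indices_eq_iff:
  assumes "U \<in> P" "V \<in> P" "i \<in> rel_indices d R U V"
  shows "i \<le> d" "i \<in> I \<longleftrightarrow> U = V"
proof -
  obtain x y where xy: "i \<le> d" "(x, y) \<in> R i" "x \<in> U" "y \<in> V"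
    using assms(3) by (auto simp: rel_indices_def)
  show "i \<le> d" by fact
  show "i \<in> I \<longleftrightarrow> U = V"
    unfolding mem_I_iff[OF xy(1,2)] using assms(1,2) xy fibre_unique by metis
qed

lemma block_adj: "block U V (adj S) = adj (S \<inter> U \<times> V)"
  by (auto simp: block_def adj_def vec_eq_iff)

section \<open>Products of blocks from linked pairs\<close>

context
  fixes l :: nat
  assumes l: "1 \<le> l" "2 * l < d + 2"
    and link: "\<And>j. j < l \<Longrightarrow> linked j (d - j)"
    and fixed: "\<And>j. l \<le> j \<Longrightarrow> j \<le> d - l \<Longrightarrow> bdiag (E j) = E j"
begin

text \<open>Agrees with \<open>M\<close> on all off-diagonal blocks, but is a combination of idempotents between which
  a coordinate projection \<open>pr V\<close> can be cancelled.\<close>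

definition proxy :: "real ^ 'x ^ 'x \<Rightarrow> real ^ 'x ^ 'x" where
  "proxy M = (\<Sum>j<l. (coef j M - coef (d - j) M) *\<^sub>R E j)"

lemma low_le: "j < l \<Longrightarrow> j \<le> d"
  using linked_le[OF link] by blast

text \<open>Fixed idempotents have no off-diagonal part. In a linked pair the sum is block diagonal,
  so the two off-diagonal parts are opposite and the coefficients get subtracted.\<close>

lemma diff_bdiag_eq:
  assumes "M \<in> \<A>"
  shows "M - bdiag M = (\<Sum>j<l. (coef j M - coef (d - j) M) *\<^sub>R (E j - bdiag (E j)))"
proof -
  let ?g = "\<lambda>k. coef k M *\<^sub>R (E k - bdiag (E k))"
  have "M - bdiag M = (\<Sum>k\<le>d. coef k M *\<^sub>R E k) - bdiag (\<Sum>k\<le>d. coef k M *\<^sub>R E k)"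
    using \<A>_expand[OF assms] by simp
  also have "\<dots> = (\<Sum>k\<le>d. ?g k)"
    by (simp add: bdiag_sum bdiag_linear scaleR_diff_right sum_subtractf)
  also have "\<dots> = (\<Sum>k\<in>{..<l} \<union> {d + 1 - l..d}. ?g k)"
  proof (rule sum.mono_neutral_right)
    show "\<forall>k\<in>{..d} - ({..<l} \<union> {d + 1 - l..d}). ?g k = 0"
      using l by (auto simp: fixed)
  qed (use l in auto)
  also have "\<dots> = (\<Sum>k<l. ?g k) + (\<Sum>k\<in>{d + 1 - l..d}. ?g k)"
    using l by (intro sum.union_disjoint) auto
  also have "(\<Sum>k\<in>{d + 1 - l..d}. ?g k) = (\<Sum>k<l. ?g (d - k))"
    using l by (intro sum.reindex_bij_witness[of _ "\<lambda>k. d - k" "\<lambda>k. d - k"]) auto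
  also have "\<dots> = (\<Sum>k<l. - (coef (d - k) M *\<^sub>R (E k - bdiag (E k))))"
  proof (intro sum.cong refl)
    fix k assume "k \<in> {..<l}"
    then have lk: "linked k (d - k)" using link by simp
    have "E (d - k) - bdiag (E (d - k)) = - (E k - bdiag (E k))"
      using linked_bdiag_sum[OF lk] by (simp add: bdiag_linear algebra_simps)
    then show "?g (d - k) = - (coef (d - k) M *\<^sub>R (E k - bdiag (E k)))" by (simp only: scaleR_minus_right)
  qed
  finally show ?thesis
    by (simp add: sum_negf scaleR_left_diff_distrib sum_subtractf)
qed

lemma proxy_block:
  assumes "M \<in> \<A>" "U \<in> P" "V \<in> P" "U \<noteq> V"
  shows "pr U ** M ** pr V = pr U ** proxy M ** pr V"
proof -
  have "pr U ** M ** pr V = pr U ** (M - bdiag M) ** pr V"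
    using assms by (simp add: matrix_distribs bdiag_block)
  also have "\<dots> = pr U ** proxy M ** pr V"
    unfolding diff_bdiag_eq[OF assms(1)] proxy_def using assms
    by (simp add: matrix_mul_sum matrix_distribs bdiag_block)
  finally show ?thesis .
qed

lemma E_pr_E_low:
  assumes "j < l" "k < l" "V \<in> P"
  shows "E j ** pr V ** E k = (if j = k then (1 / real w) *\<^sub>R E k else 0)"
proof (cases "j = k")
  case True
  then show ?thesis using linked_E_pr_E[OF link] assms by simp
next
  case False
  moreover have "k \<noteq> d - j" using assms l by auto
  ultimately show ?thesis
    using linked_E_pr_E_orthogonal[OF link[OF assms(1)] assms(3) low_le[OF assms(2)]] by simp
qed

lemma proxy_pr_E:
  assumes "k < l" "V \<in> P"
  shows "proxy M ** pr V ** E k = ((coef k M - coef (d - k) M) / real w) *\<^sub>R E k"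
proof -
  have "proxy M ** pr V ** E k = (\<Sum>j<l. (coef j M - coef (d - j) M) *\<^sub>R (E j ** pr V ** E k))"
    by (simp add: proxy_def matrix_mul_sum)
  also have "\<dots> = (\<Sum>j<l. if j = k then ((coef k M - coef (d - k) M) / real w) *\<^sub>R E k else 0)"
    using assms by (intro sum.cong) (auto simp: E_pr_E_low)
  finally show ?thesis using assms by simp
qed

text \<open>The middle fibre contributes only the factor \<open>1 / w\<close>, whichever fibre it
  is.\<close>

lemma proxy_mult:
  obtains X where "X \<in> \<A>" "\<And>V. V \<in> P \<Longrightarrow> proxy M ** pr V ** proxy N = X"
proof
  let ?X = "\<Sum>k<l. (coef k N - coef (d - k) N) *\<^sub>R (((coef k M - coef (d - k) M) / real w) *\<^sub>R E k)"
  show "?X \<in> \<A>" using low_le by (intro \<A>_intros) auto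
  show "proxy M ** pr V ** proxy N = ?X" if "V \<in> P" for V
    unfolding proxy_def[of N] matrix_mul_sum(2) using that
    by (intro sum.cong refl) (simp add: proxy_pr_E)
qed

text \<open>If one relation lies inside the fibres, its matrix commutes with \<open>pr V\<close>,
  and \<open>X\<close> is the ordinary product. Otherwise both blocks are off-diagonal and can be
  replaced by those of the proxies.\<close>

lemma block_product_exists:
  assumes "i \<le> d" "j \<le> d"
  obtains X where "X \<in> \<A>"
    "\<And>U V W. U \<in> P \<Longrightarrow> V \<in> P \<Longrightarrow> W \<in> P \<Longrightarrow> i \<in> rel_indices d R U V \<Longrightarrow> j \<in> rel_indices d R V W \<Longrightarrow>
      block U V (adj (R i)) ** block V W (adj (R j)) = block U W X"
proof (cases "i \<in> I \<or> j \<in> I")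
  case True
  show ?thesis
  proof
    show "adj (R i) ** adj (R j) \<in> \<A>" using assms adj_in \<A>_mult by blast
    fix U V W
    assume UVW: "U \<in> P" "V \<in> P" "W \<in> P" and rel: "i \<in> rel_indices d R U V" "j \<in> rel_indices d R V W"
    have split: "block U V (adj (R i)) ** block V W (adj (R j)) = pr U ** adj (R i) ** pr V ** adj (R j) ** pr W"
      by (simp add: block_eq matrix_mul_assoc coord_proj_idem')
    show "block U V (adj (R i)) ** block V W (adj (R j)) = block U W (adj (R i) ** adj (R j))"
    proof (cases "i \<in> I")
      case True
      then have "U = V" using rel_indices_eq_iff[OF UVW(1,2) rel(1)] by simp
      moreover have "adj (R i) ** pr V = pr V ** adj (R i)"
        using bdiag_fixed_commute[of "adj (R i)" V] bdiag_adj[OF assms(1)] True UVW by simp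
      ultimately have "pr U ** adj (R i) ** pr V = pr U ** adj (R i)"
        by (metis coord_proj_idem matrix_mul_assoc)
      then show ?thesis unfolding split by (simp add: block_eq matrix_mul_assoc)
    next
      case False
      with \<open>i \<in> I \<or> j \<in> I\<close> have jI: "j \<in> I" by simp
      then have "V = W" using rel_indices_eq_iff[OF UVW(2,3) rel(2)] by simp
      moreover have "adj (R j) ** pr V = pr V ** adj (R j)"
        using bdiag_fixed_commute[of "adj (R j)" V] bdiag_adj[OF assms(2)] jI UVW by simp
      ultimately have "pr V ** adj (R j) ** pr W = adj (R j) ** pr W"
        by (metis coord_proj_idem matrix_mul_assoc)
      then show ?thesis unfolding split block_eq by (metis matrix_mul_assoc)
    qed
  qed
next
  case False
  obtain X where X: "X \<in> \<A>" "\<And>V. V \<in> P \<Longrightarrow> proxy (adj (R i)) ** pr V ** proxy (adj (R j)) = X"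
    using proxy_mult[of "adj (R i)" "adj (R j)"] by blast
  show ?thesis
  proof
    show "X \<in> \<A>" by fact
    fix U V W
    assume UVW: "U \<in> P" "V \<in> P" "W \<in> P" and rel: "i \<in> rel_indices d R U V" "j \<in> rel_indices d R V W"
    have neq: "U \<noteq> V" "V \<noteq> W" using False rel_indices_eq_iff UVW rel by blast+
    have "block U V (adj (R i)) ** block V W (adj (R j)) =
        (pr U ** proxy (adj (R i)) ** pr V) ** (pr V ** proxy (adj (R j)) ** pr W)"
      unfolding block_eq using proxy_block adj_in assms UVW neq by simp
    also have "\<dots> = pr U ** (proxy (adj (R i)) ** pr V ** proxy (adj (R j))) ** pr W"
      by (simp add: matrix_mul_assoc coord_proj_idem')
    finally show "block U V (adj (R i)) ** block V W (adj (R j)) = block U W X"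
      using X(2)[OF UVW(2)] by (simp add: block_eq)
  qed
qed

text \<open>If \<open>R i\<close> missed an off-diagonal block, multiplying the vanishing proxy
  block by \<open>E k\<close> would isolate each coefficient of the proxy. All would be zero, so
  \<open>adj (R i)\<close> would be block diagonal, contradicting
  \<open>i \<notin> I\<close>.\<close>

lemma rel_indices_off_diagonal:
  assumes "U \<in> P" "V \<in> P" "U \<noteq> V"
  shows "rel_indices d R U V = {..d} - I"
proof
  show "rel_indices d R U V \<subseteq> {..d} - I" using rel_indices_eq_iff[OF assms(1,2)] assms(3) by blast
  show "{..d} - I \<subseteq> rel_indices d R U V"
  proof
    fix i assume "i \<in> {..d} - I"
    then have i: "i \<le> d" "i \<notin> I" by auto
    let ?M = "adj (R i)"
    show "i \<in> rel_indices d R U V"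
    proof (rule ccontr)
      assume "i \<notin> rel_indices d R U V"
      then have "R i \<inter> U \<times> V = {}" using i by (simp add: rel_indices_def)
      then have "block U V ?M = 0" by (simp add: block_adj) (simp add: adj_def vec_eq_iff)
      then have zero: "pr U ** proxy ?M ** pr V = 0"
        using proxy_block[OF adj_in[OF i(1)] assms] by (simp add: block_eq)
      have "coef k ?M - coef (d - k) ?M = 0" if k: "k < l" for k
      proof -
        let ?c = "coef k ?M - coef (d - k) ?M"
        have "0 = pr U ** (proxy ?M ** pr V ** E k)" using zero by (simp add: matrix_mul_assoc)
        then have "(?c / real w) *\<^sub>R (pr U ** E k) = 0" using proxy_pr_E[OF k assms(2)] by simp
        moreover have "trace (pr U ** E k) > 0"
          using trace_pr_pos[OF _ _ _ assms(1)] E_in E_idem E_nonzero low_le[OF k] by blast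
        then have "pr U ** E k \<noteq> 0" by auto
        ultimately show ?thesis using w_real by simp
      qed
      then have "?M - bdiag ?M = 0" unfolding diff_bdiag_eq[OF adj_in[OF i(1)]] by simp
      then have "?M = 0" using bdiag_adj[OF i(1)] i(2) by simp
      then have "R i = {}" by (auto simp: adj_def vec_eq_iff split: if_splits)
      then show False using assoc_scheme_nonempty[OF scheme i(1)] by simp
    qed
  qed
qed

lemma uniform_if_linked: "uniform_scheme d R P I"
proof -
  define good where "good i j c \<longleftrightarrow> (\<forall>U\<in>P. \<forall>V\<in>P. \<forall>W\<in>P.
      i \<in> rel_indices d R U V \<longrightarrow> j \<in> rel_indices d R V W \<longrightarrow>
      block U V (adj (R i)) ** block V W (adj (R j)) =
        (\<Sum>h\<le>d. real_of_int (c h) *\<^sub>R block U W (adj (R h))))" for i j and c :: "nat \<Rightarrow> int"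
  have ex: "\<exists>c. good i j c" if ij: "i \<le> d" "j \<le> d" for i j
  proof -
    obtain X where X: "X \<in> \<A>" "\<And>U V W. U \<in> P \<Longrightarrow> V \<in> P \<Longrightarrow> W \<in> P \<Longrightarrow> i \<in> rel_indices d R U V \<Longrightarrow>
        j \<in> rel_indices d R V W \<Longrightarrow> block U V (adj (R i)) ** block V W (adj (R j)) = block U W X"
      using block_product_exists[OF ij] by blast
    obtain c where c: "\<And>h x y. h \<le> d \<Longrightarrow> (x, y) \<in> R h \<Longrightarrow> X $ x $ y = c h"
      using X(1) bose_mesner_iff[OF scheme] by metis
    \<comment> \<open>If \<open>R h\<close> meets \<open>U \<times> W\<close>, then
      \<open>c h\<close> counts points and is an integer, so the floor changes nothing. Otherwise
      the floor multiplies a zero block.\<close>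
    have "block U V (adj (R i)) ** block V W (adj (R j)) =
        (\<Sum>h\<le>d. real_of_int \<lfloor>c h\<rfloor> *\<^sub>R block U W (adj (R h)))"
      if UVW: "U \<in> P" "V \<in> P" "W \<in> P" "i \<in> rel_indices d R U V" "j \<in> rel_indices d R V W" for U V W
    proof -
      let ?Y = "\<Sum>h\<le>d. real_of_int \<lfloor>c h\<rfloor> *\<^sub>R adj (R h)"
      have "block U W X $ x $ y = block U W ?Y $ x $ y" for x y
      proof (cases "x \<in> U \<and> y \<in> W")
        case True
        obtain h where h: "h \<le> d" "(x, y) \<in> R h" using assoc_scheme_cover[OF scheme] .
        have "block U W X $ x $ y = c h" using True c[OF h] by (simp add: block_def)
        moreover have "block U W X = adj (R i \<inter> U \<times> V) ** adj (R j \<inter> V \<times> W)"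
          using X(2)[OF UVW] by (simp add: block_adj)
        ultimately have "c h = (adj (R i \<inter> U \<times> V) ** adj (R j \<inter> V \<times> W)) $ x $ y" by simp
        then have "real_of_int \<lfloor>c h\<rfloor> = c h" unfolding adj_mult_nth by simp
        moreover have "block U W ?Y $ x $ y = real_of_int \<lfloor>c h\<rfloor>"
          using True assoc_scheme_sum_adj_nth[OF scheme h, of "\<lambda>h. real_of_int \<lfloor>c h\<rfloor>"]
          by (simp add: block_def)
        ultimately show ?thesis using \<open>block U W X $ x $ y = c h\<close> by (simp only:)
      qed (auto simp: block_def)
      then have "block U W X = block U W ?Y" unfolding vec_eq_iff by blast
      then show ?thesis using X(2)[OF UVW] by (simp add: block_eq matrix_mul_sum)
    qed
    then have "good i j (\<lambda>h. \<lfloor>c h\<rfloor>)" unfolding good_def by blast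
    then show ?thesis by blast
  qed
  define a where "a i j = (SOME c. good i j c)" for i j
  have "good i j (a i j)" if "i \<le> d" "j \<le> d" for i j
    using someI_ex[OF ex[OF that]] by (simp add: a_def)
  then have "\<forall>U\<in>P. \<forall>V\<in>P. \<forall>W\<in>P. \<forall>i\<in>rel_indices d R U V. \<forall>j\<in>rel_indices d R V W.
          block U V (adj (R i)) ** block V W (adj (R j)) =
            (\<Sum>h\<le>d. real_of_int (a i j h) *\<^sub>R block U W (adj (R h)))"
    using rel_indices_eq_iff(1) unfolding good_def by simp
  then show ?thesis
    unfolding uniform_scheme_def using rel_indices_off_diagonal
    by (intro conjI exI[of _ "\<lambda>h i j. a i j h"]) blast+
qed

end

theorem Q_Higman_imp_uniform:
  assumes "Q_Higman d E J"
  shows "uniform_scheme d R P I"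
proof -
  obtain l \<sigma> where l: "1 \<le> l" "2 * l < d + 2" and \<sigma>: "\<sigma> permutes {..d}" "\<sigma> 0 = 0"
    and Q: "Q_Higman_wrt d (E \<circ> \<sigma>) {j. j \<le> d \<and> \<sigma> j \<in> J} l"
    using assms unfolding Q_Higman_def by blast
  interpret S: imprimitive_scheme R "E \<circ> \<sigma>" d P w n I "{j. j \<le> d \<and> \<sigma> j \<in> J}" using reorder[OF \<sigma>] .
  show ?thesis
    using S.uniform_if_linked[OF l] S.linked_if_Q_Higman_wrt[OF Q l] by blast
qed

end

theorem theorem4p16:
  fixes R :: "nat \<Rightarrow> ('x::finite \<times> 'x) set"
    and E :: "nat \<Rightarrow> real ^ 'x ^ 'x"
    and P :: "'x set set"
    and I J :: "nat set"
    and d w n :: nat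
  assumes "assoc_scheme d R"
    and "idempotent_ordering d R E"
    and "imprimitivity_system d R E P w n I J"
  shows "uniform_scheme d R P I \<longleftrightarrow> Q_Higman d E J"
proof -
  interpret imprimitive_scheme R E d P w n I J
    using assms by unfold_locales
  show ?thesis using uniform_imp_Q_Higman Q_Higman_imp_uniform by blast
qed

end
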